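(* Let $a\ge b\ge 1$ and $s\ge 1$ be integers. Let $P_1,\ldots,P_s$ be points in general position in $\mathbb{P}^1\times\mathbb{P}^1$ (over $\mathbb{C}$) and let $\mathbb{X}=3P_1+\cdots+3P_s\subset\mathbb{P}^1\times\mathbb{P}^1$. Then $$\mathrm{HF}_{\mathbb{X}}(a,b)=\min\{(a+1)(b+1),\,6s\},$$ except in the following cases: (1) $b=1$ and $s<\frac{2}{5}(a+1)$, where $\mathrm{HF}_{\mathbb{X}}(a,1)=5s$; (2) $s$ is odd, say $s=2k+1$, and - $(a,b)=(4k+1,2)$, where $\mathrm{HF}_{\mathbb{X}}(4k+1,2)=(a+1)(b+1)-1$; - $(a,b)=(3k,3)$, where $\mathrm{HF}_{\mathbb{X}}(3k,3)=(a+1)(b+1)-1$; - $(a,b)=(3k+1,3)$, where $\mathrm{HF}_{\mathbb{X}}(3k+1,3)=6s-1$; (3) $s=5$ and $(a,b)=(5,4)$, where $\mathrm{HF}_{\mathbb{X}}(5,4)=29$.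
   Context: Let $S=\mathbb{C}[x_0,x_1;y_0,y_1]=\bigoplus_{i,j}S_{(i,j)}$ be the bi-graded coordinate ring of $\mathbb{P}^1\times\mathbb{P}^1$, where $S_{(i,j)}$ is the space of bi-homogeneous polynomials of bi-degree $(i,j)$. For points $P_1,\ldots,P_s\in\mathbb{P}^1\times\mathbb{P}^1$ with bi-homogeneous prime ideals $\wp_1,\ldots,\wp_s\subset S$, the scheme $\mathbb{X}=3P_1+\cdots+3P_s$ is defined by the ideal $I_{\mathbb{X}}=\wp_1^3\cap\cdots\cap\wp_s^3$, and $\mathrm{HF}_{\mathbb{X}}(a,b)=\dim_{\mathbb{C}}(S/I_{\mathbb{X}})_{(a,b)}=(a+1)(b+1)-\dim_{\mathbb{C}}(I_{\mathbb{X}})_{(a,b)}$. "In general position" means that the assertion holds for all $(P_1,\ldots,P_s)$ in some nonempty Zariski open subset of $(\mathbb{P}^1\times\mathbb{P}^1)^s$ (which may depend on $a,b,s$). *)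

theory Defs
  imports Complex_Main "HOL-Library.Poly_Mapping" "HOL-Library.FuncSet"
begin

subsection \<open>Polynomials over the complex numbers\<close>

text \<open>A polynomial in variables \<open>'v\<close> is a finitely supported map from exponent vectors to
  coefficients; the ring structure is the one of \<^theory>\<open>HOL-Library.Poly_Mapping\<close>.\<close>

type_synonym 'v cpoly = "('v \<Rightarrow>\<^sub>0 nat) \<Rightarrow>\<^sub>0 complex"

definition cpoly_eval :: "('v \<Rightarrow> complex) \<Rightarrow> 'v cpoly \<Rightarrow> complex" where
  "cpoly_eval c F =
     (\<Sum>m\<in>Poly_Mapping.keys F. Poly_Mapping.lookup F m *
        (\<Prod>v\<in>Poly_Mapping.keys m. c v ^ Poly_Mapping.lookup m v))"

definition cpoly_scale :: "complex \<Rightarrow> 'v cpoly \<Rightarrow> 'v cpoly" where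
  "cpoly_scale c F = Poly_Mapping.map ((*) c) F"

lemma lookup_cpoly_scale [simp]:
  "Poly_Mapping.lookup (cpoly_scale c F) m = c * Poly_Mapping.lookup F m"
  by (simp add: cpoly_scale_def Poly_Mapping.map.rep_eq when_def)

interpretation cpoly: vector_space "cpoly_scale :: complex \<Rightarrow> 'v cpoly \<Rightarrow> 'v cpoly"
  by unfold_locales (auto intro!: poly_mapping_eqI simp: lookup_add algebra_simps)

text \<open>A commutative ring as a module over itself: \<open>ideal.span B\<close> is the ideal generated by \<open>B\<close>.\<close>

interpretation ideal: module "(*) :: 'a::comm_ring_1 \<Rightarrow> 'a \<Rightarrow> 'a"
  by unfold_locales (simp_all add: algebra_simps)

primrec ideal_power :: "'a::comm_ring_1 set \<Rightarrow> nat \<Rightarrow> 'a set" where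
  "ideal_power I 0 = UNIV"
| "ideal_power I (Suc n) = ideal.span {f * g | f g. f \<in> I \<and> g \<in> ideal_power I n}"

subsection \<open>The bi-graded coordinate ring of the product of two projective lines\<close>

datatype coord = X0 | X1 | Y0 | Y1

definition bidegree :: "(coord \<Rightarrow> nat) \<Rightarrow> nat \<times> nat" where
  "bidegree m = (m X0 + m X1, m Y0 + m Y1)"

definition bihomogeneous :: "nat \<Rightarrow> nat \<Rightarrow> coord cpoly set" where
  "bihomogeneous i j =
     {F. \<forall>m\<in>Poly_Mapping.keys F. bidegree (Poly_Mapping.lookup m) = (i, j)}"

subsection \<open>Points\<close>

definition proportional :: "complex \<times> complex \<Rightarrow> complex \<times> complex \<Rightarrow> bool" where
  "proportional u v \<longleftrightarrow> u \<noteq> (0, 0) \<and> v \<noteq> (0, 0) \<and>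
     (\<exists>c. c \<noteq> 0 \<and> v = (c * fst u, c * snd u))"

quotient_type p1 = "complex \<times> complex" / partial: proportional
proof (rule part_equivpI)
  show "\<exists>u. proportional u u"
    by (rule exI[of _ "(1, 0)"]) (auto simp: proportional_def intro!: exI[of _ 1])
  show "symp proportional"
  proof (rule sympI)
    fix u v assume "proportional u v"
    then obtain c where "u \<noteq> (0, 0)" "v \<noteq> (0, 0)" "c \<noteq> 0" "v = (c * fst u, c * snd u)"
      unfolding proportional_def by blast
    then show "proportional v u"
      unfolding proportional_def by (intro conjI exI[of _ "1 / c"]) simp_all
  qed
  show "transp proportional"
  proof (rule transpI)
    fix u v w assume "proportional u v" "proportional v w"
    then obtain c d where "u \<noteq> (0, 0)" "w \<noteq> (0, 0)" "c \<noteq> 0" "d \<noteq> 0"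
      "v = (c * fst u, c * snd u)" "w = (d * fst v, d * snd v)"
      unfolding proportional_def by blast
    then show "proportional u w"
      unfolding proportional_def by (intro conjI exI[of _ "d * c"]) simp_all
  qed
qed

lift_definition p1_coords :: "p1 \<Rightarrow> (complex \<times> complex) set" is
  "\<lambda>u. {v. proportional u v}"
  using Quotient3_p1 by (auto dest!: Quotient3_part_equivp elim!: part_equivpE dest: sympD transpD)

definition point_coords :: "p1 \<times> p1 \<Rightarrow> (coord \<Rightarrow> complex) set" where
  "point_coords P = {c. (c X0, c X1) \<in> p1_coords (fst P) \<and> (c Y0, c Y1) \<in> p1_coords (snd P)}"

definition point_ideal :: "p1 \<times> p1 \<Rightarrow> coord cpoly set" where
  "point_ideal P = ideal.span
     {F. (\<exists>i j. F \<in> bihomogeneous i j) \<and> (\<forall>c\<in>point_coords P. cpoly_eval c F = 0)}"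

text \<open>The ideal of \<open>3P\<^sub>1 + \<dots> + 3P\<^sub>s\<close>; the points are \<open>P 0, \<dots>, P (s - 1)\<close>.\<close>

definition triple_points_ideal :: "nat \<Rightarrow> (nat \<Rightarrow> p1 \<times> p1) \<Rightarrow> coord cpoly set" where
  "triple_points_ideal s P = (\<Inter>i<s. ideal_power (point_ideal (P i)) 3)"

text \<open>The Hilbert function of \<open>S / I\<close> for a bi-homogeneous ideal \<open>I\<close> of \<open>S\<close>.  The lemmas
  after the definition show that \<open>(a + 1) * (b + 1)\<close> is the dimension of the bi-graded piece of
  \<open>S\<close> and that the subtraction does not truncate.\<close>

definition hilbert_function :: "coord cpoly set \<Rightarrow> nat \<Rightarrow> nat \<Rightarrow> nat" where
  "hilbert_function I a b = (a + 1) * (b + 1) - cpoly.dim (I \<inter> bihomogeneous a b)"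

lemma dim_bihomogeneous_aux:
  fixes a b :: nat
  defines "M \<equiv> {m. bidegree (Poly_Mapping.lookup m) = (a, b)}"
  defines "B \<equiv> (\<lambda>m. Poly_Mapping.single m (1::complex)) ` M"
  shows "finite B" and "card B = (a + 1) * (b + 1)"
    and "cpoly.independent B" and "cpoly.span B = bihomogeneous a b"
proof -
  define e :: "(coord \<Rightarrow>\<^sub>0 nat) \<Rightarrow> nat \<times> nat"
    where "e = (\<lambda>m. (Poly_Mapping.lookup m X0, Poly_Mapping.lookup m Y0))"
  define g :: "nat \<times> nat \<Rightarrow> coord \<Rightarrow>\<^sub>0 nat"
    where "g = (\<lambda>(i, j). Poly_Mapping.single X0 i + Poly_Mapping.single X1 (a - i) +
      Poly_Mapping.single Y0 j + Poly_Mapping.single Y1 (b - j))"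
  have "bij_betw e M ({..a} \<times> {..b})"
  proof (rule bij_betwI[where g = g])
    show "e \<in> M \<rightarrow> {..a} \<times> {..b}"
      by (auto simp: e_def M_def bidegree_def)
    show "g \<in> {..a} \<times> {..b} \<rightarrow> M"
      by (auto simp: g_def M_def bidegree_def lookup_add lookup_single)
  next
    fix m assume "m \<in> M"
    then show "g (e m) = m"
      unfolding e_def g_def prod.case
      by (intro poly_mapping_eqI, case_tac k)
        (auto simp: M_def bidegree_def lookup_add lookup_single)
  next
    fix y assume "y \<in> {..a} \<times> {..b}"
    then show "e (g y) = y"
      by (auto simp: e_def g_def lookup_add lookup_single)
  qed
  then have fin: "finite M" and card: "card M = (a + 1) * (b + 1)"
    by (auto dest: bij_betw_finite bij_betw_same_card)
  have inj: "inj_on (\<lambda>m. Poly_Mapping.single m (1::complex)) M"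
    by (rule inj_onI) (metis lookup_single_eq lookup_single_not_eq zero_neq_one)
  show finB: "finite B" and "card B = (a + 1) * (b + 1)"
    using fin card inj by (simp_all add: B_def card_image)
  have expand: "Poly_Mapping.lookup (\<Sum>m\<in>M. cpoly_scale (f m) (Poly_Mapping.single m 1)) k =
      (if k \<in> M then f k else 0)" for f k
    using fin by (simp add: lookup_sum lookup_single when_def if_distrib cong: if_cong)
  show "cpoly.independent B"
  proof (rule cpoly.independent_if_scalars_zero[OF finB])
    fix f x assume sum: "(\<Sum>x\<in>B. cpoly_scale (f x) x) = 0" and "x \<in> B"
    then obtain k where k: "k \<in> M" "x = Poly_Mapping.single k 1" by (auto simp: B_def)
    have "(\<Sum>m\<in>M. cpoly_scale (f (Poly_Mapping.single m 1)) (Poly_Mapping.single m 1)) = 0"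
      using sum by (simp add: B_def sum.reindex[OF inj])
    from arg_cong[OF this, of "\<lambda>F. Poly_Mapping.lookup F k"] show "f x = 0"
      using k by (simp only: expand) simp
  qed
  show "cpoly.span B = bihomogeneous a b"
  proof
    have "cpoly.subspace (bihomogeneous a b)"
      unfolding cpoly.subspace_def bihomogeneous_def
      by (auto simp: in_keys_iff lookup_add)
    moreover have "B \<subseteq> bihomogeneous a b"
      by (auto simp: B_def M_def bihomogeneous_def)
    ultimately show "cpoly.span B \<subseteq> bihomogeneous a b"
      by (rule cpoly.span_minimal[rotated])
    show "bihomogeneous a b \<subseteq> cpoly.span B"
    proof
      fix F assume "F \<in> bihomogeneous a b"
      then have "F = (\<Sum>m\<in>M. cpoly_scale (Poly_Mapping.lookup F m) (Poly_Mapping.single m 1))"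
        by (intro poly_mapping_eqI) (auto simp only: expand, auto simp: bihomogeneous_def M_def in_keys_iff)
      also have "\<dots> \<in> cpoly.span B"
        by (intro cpoly.span_sum cpoly.span_scale cpoly.span_base) (simp add: B_def)
      finally show "F \<in> cpoly.span B" .
    qed
  qed
qed

lemma dim_bihomogeneous: "cpoly.dim (bihomogeneous a b) = (a + 1) * (b + 1)"
  using dim_bihomogeneous_aux[of a b] by (metis cpoly.dim_span_eq_card_independent)

lemma dim_Int_bihomogeneous_le: "cpoly.dim (I \<inter> bihomogeneous a b) \<le> (a + 1) * (b + 1)"
  using dim_bihomogeneous_aux[of a b] by (metis cpoly.dim_le_card inf_le2)

subsection \<open>Configurations of points in general position\<close>

text \<open>The variety of ordered \<open>s\<close>-tuples of points of the surface, as functions on \<open>{..<s}\<close>.  Its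
  closed subsets are the common zero loci of polynomials in the coordinates of all the points
  that are bi-homogeneous in the four coordinates of each of them.\<close>

definition configurations :: "nat \<Rightarrow> (nat \<Rightarrow> p1 \<times> p1) set" where
  "configurations s = {..<s} \<rightarrow>\<^sub>E UNIV"

definition multihomogeneous :: "nat \<Rightarrow> (nat \<times> coord) cpoly \<Rightarrow> bool" where
  "multihomogeneous s F \<longleftrightarrow>
     (\<forall>m\<in>Poly_Mapping.keys F. Poly_Mapping.keys m \<subseteq> {..<s} \<times> UNIV) \<and>
     (\<exists>d. \<forall>m\<in>Poly_Mapping.keys F. \<forall>i<s. bidegree (\<lambda>v. Poly_Mapping.lookup m (i, v)) = d i)"

definition vanishes_at :: "nat \<Rightarrow> (nat \<times> coord) cpoly \<Rightarrow> (nat \<Rightarrow> p1 \<times> p1) \<Rightarrow> bool" where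
  "vanishes_at s F P \<longleftrightarrow>
     (\<forall>c. (\<forall>i<s. (\<lambda>v. c (i, v)) \<in> point_coords (P i)) \<longrightarrow> cpoly_eval c F = 0)"

definition zariski_closed :: "nat \<Rightarrow> (nat \<Rightarrow> p1 \<times> p1) set \<Rightarrow> bool" where
  "zariski_closed s Z \<longleftrightarrow>
     (\<exists>\<F>. (\<forall>F\<in>\<F>. multihomogeneous s F) \<and>
          Z = {P \<in> configurations s. \<forall>F\<in>\<F>. vanishes_at s F P})"

definition zariski_open :: "nat \<Rightarrow> (nat \<Rightarrow> p1 \<times> p1) set \<Rightarrow> bool" where
  "zariski_open s U \<longleftrightarrow>
     U \<subseteq> configurations s \<and> zariski_closed s (configurations s - U)"

definition in_general_position :: "nat \<Rightarrow> ((nat \<Rightarrow> p1 \<times> p1) \<Rightarrow> bool) \<Rightarrow> bool" where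
  "in_general_position s Q \<longleftrightarrow> (\<exists>U. zariski_open s U \<and> U \<noteq> {} \<and> (\<forall>P\<in>U. Q P))"

end

theory Submission
  imports Defs "Jordan_Normal_Form.Determinant"
begin

text \<open>The forms of bi-degree \<open>(a, b)\<close> are spanned by the monomials of the lattice rectangle with
  \<open>a + 1\<close> columns and \<open>b + 1\<close> rows, and the Hilbert function counts the independent conditions that
  the triple points impose on them.  Two bounds have to meet.

  Upper bound, for every configuration: modulo \<open>\<wp>\<^sup>3\<close> every form is a combination of the products
  \<open>l\<^sup>i X\<^sup>a\<^sup>-\<^sup>i m\<^sup>j Y\<^sup>b\<^sup>-\<^sup>j\<close> with \<open>i + j \<le> 2\<close>, where \<open>l\<close> and \<open>m\<close> are the two rulings through the
  point; that is at most six conditions, and at most five if \<open>b = 1\<close>.  In the remaining exceptional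
  cases there are forms that the count does not predict.  If \<open>s < (i + 1) (j + 1)\<close>, a curve \<open>C\<close> of
  bi-degree \<open>(i, j)\<close> passes through the \<open>s\<close> points, and \<open>C\<^sup>2 D\<close> is triple at all of them for every
  curve \<open>D\<close> through them (\<open>dim_double_curve\<close>).  With \<open>C\<close> of bi-degree \<open>(k, 1)\<close>, or \<open>(2, 1)\<close> for five
  points, this accounts for every exception.

  Lower bound, for general configurations: by semicontinuity (\<open>independent_conditions_general\<close>) a
  single configuration of points and a set \<open>C\<close> of monomials of the right size suffice, such that no
  nonzero polynomial with support in \<open>C\<close> is triple at all the points.  A polynomial
  \<open>\<Sum> g\<^sub>e x\<^sup>e\<close> is triple at a point \<open>z\<close> of the torus iff \<open>\<Sum> g\<^sub>e q(e) z\<^sup>e = 0\<close> for all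
  quadratic polynomials \<open>q\<close> in the exponent.  So one point suffices for six lattice points that do
  not lie on a conic.  If a line separates \<open>C\<close> from \<open>E\<close>, if \<open>n\<close> points suffice for \<open>C\<close> and \<open>m\<close>
  points for \<open>E\<close>, then \<open>n + m\<close> points suffice for the union: the torus action moves the \<open>n\<close> points
  to infinity in the direction normal to the line, and in the limit the linear system splits into
  two blocks (\<open>determined_cut\<close>; this is Dumnicki's method of cutting diagrams).  Hence it remains
  to cut rectangles by lines into six-point sets that are not on a conic, with a small rest.  A
  \<open>4 \<times> 3\<close> rectangle falls into two triangles.  Strips made of such pieces reduce every rectangle
  with at least five rows and columns to finitely many small ones, for which partitions are given
  explicitly, except for \<open>6 \<times> 5\<close>, where the last cut leaves six points of rank five.  In
  rectangles with two, three or four rows the rest at the end of the strip yields just the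
  exceptions of the theorem.\<close>

text \<open>The ring is a module over itself by \<open>ideal\<close>; as a rewrite rule, this module axiom brackets
  products to the left and would counteract \<open>mult.assoc\<close>.\<close>

declare ideal.scale_scale [simp del]

section \<open>Polynomials with prescribed support that vanish to order three at points of the torus\<close>

text \<open>Order-three vanishing in terms of exponents: the operators of order at most two in \<open>x
  \<partial>/\<partial>x\<close> and \<open>y \<partial>/\<partial>y\<close> multiply \<open>x\<^sup>u
  y\<^sup>v\<close> by the polynomials of degree at most two in \<open>(u, v)\<close>, and on the torus
  they generate the same conditions as the partial derivatives. Exponents are integers so that lattice
  sets can be translated.\<close>

definition quadratic :: "(int \<times> int \<Rightarrow> complex) \<Rightarrow> bool" where
  "quadratic q \<longleftrightarrow> (\<exists>k a b c d e. \<forall>u v. q (u, v) =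
     k + a * of_int u + b * of_int v + c * of_int u ^ 2 + d * of_int u * of_int v + e * of_int v ^ 2)"

definition monom_at :: "complex \<times> complex \<Rightarrow> int \<times> int \<Rightarrow> complex" where
  "monom_at z e = fst z powi fst e * snd z powi snd e"

text \<open>No nonzero polynomial with support in \<open>C\<close> vanishes to order three at all the points \<open>p
  0, \<dots>, p (n - 1)\<close> of the torus.\<close>

definition determining :: "(nat \<Rightarrow> complex \<times> complex) \<Rightarrow> nat \<Rightarrow> (int \<times> int) set \<Rightarrow> bool" where
  "determining p n C \<longleftrightarrow> (\<forall>i. fst (p i) \<noteq> 0 \<and> snd (p i) \<noteq> 0) \<and>
     (\<forall>g. (\<forall>i<n. \<forall>q. quadratic q \<longrightarrow> (\<Sum>e\<in>C. g e * (q e * monom_at (p i) e)) = 0) \<longrightarrow>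
        (\<forall>e\<in>C. g e = 0))"

definition determined :: "nat \<Rightarrow> (int \<times> int) set \<Rightarrow> bool" where
  "determined n C \<longleftrightarrow> finite C \<and> (\<exists>p. determining p n C)"

lemma quadraticI:
  assumes "\<And>u v. q (u, v) = k + a * of_int u + b * of_int v + c * of_int u ^ 2
      + d * of_int u * of_int v + e * of_int v ^ 2"
  shows "quadratic q"
  unfolding quadratic_def using assms by blast

lemma quadratic_zero: "quadratic (\<lambda>_. 0)"
  by (rule quadraticI[of _ 0 0 0 0 0 0]) simp

lemma quadratic_add:
  assumes "quadratic q" "quadratic r" shows "quadratic (\<lambda>x. q x + r x)"
proof -
  obtain k a b c d e where q: "\<And>u v. q (u, v) = k + a * of_int u + b * of_int v + c * of_int u ^ 2
      + d * of_int u * of_int v + e * of_int v ^ 2"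
    using assms(1) unfolding quadratic_def by blast
  obtain k' a' b' c' d' e' where r: "\<And>u v. r (u, v) = k' + a' * of_int u + b' * of_int v
      + c' * of_int u ^ 2 + d' * of_int u * of_int v + e' * of_int v ^ 2"
    using assms(2) unfolding quadratic_def by blast
  show ?thesis
    by (rule quadraticI[of _ "k + k'" "a + a'" "b + b'" "c + c'" "d + d'" "e + e'"])
      (simp add: q r algebra_simps)
qed

lemma quadratic_cmult:
  assumes "quadratic q" shows "quadratic (\<lambda>x. s * q x)"
proof -
  obtain k a b c d e where q: "\<And>u v. q (u, v) = k + a * of_int u + b * of_int v + c * of_int u ^ 2
      + d * of_int u * of_int v + e * of_int v ^ 2"
    using assms(1) unfolding quadratic_def by blast
  show ?thesis
    by (rule quadraticI[of _ "s * k" "s * a" "s * b" "s * c" "s * d" "s * e"])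
      (simp add: q algebra_simps)
qed

lemma quadratic_shift:
  assumes "quadratic q" shows "quadratic (\<lambda>(u, v). q (u + x, v + y))"
proof -
  obtain k a b c d e where q: "\<And>u v. q (u, v) = k + a * of_int u + b * of_int v + c * of_int u ^ 2
      + d * of_int u * of_int v + e * of_int v ^ 2"
    using assms(1) unfolding quadratic_def by blast
  show ?thesis
    by (rule quadraticI[of _ "q (x, y)"  "a + 2 * c * of_int x + d * of_int y"
        "b + 2 * e * of_int y + d * of_int x" c d e])
      (simp add: q power2_eq_square algebra_simps)
qed

lemma quadratic_swap:
  assumes "quadratic q" shows "quadratic (\<lambda>(u, v). q (v, u))"
proof -
  obtain k a b c d e where q: "\<And>u v. q (u, v) = k + a * of_int u + b * of_int v + c * of_int u ^ 2
      + d * of_int u * of_int v + e * of_int v ^ 2"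
    using assms(1) unfolding quadratic_def by blast
  show ?thesis
    by (rule quadraticI[of _ k b a e d c]) (simp add: q algebra_simps)
qed

lemma quadratic_mult_affine:
  "quadratic (\<lambda>e. of_int ((l * fst e + m * snd e + n) * (l' * fst e + m' * snd e + n')))"
  by (rule quadraticI[of _ "of_int (n * n')" "of_int (l * n' + n * l')" "of_int (m * n' + n * m')"
        "of_int (l * l')" "of_int (l * m' + m * l')" "of_int (m * m')"])
    (simp add: power2_eq_square algebra_simps)

text \<open>Finite-dimensional duality. In the induction step, if every member of \<open>W\<close> that vanishes on
  \<open>C\<close> also vanished at the new point \<open>d\<close>, then the value at \<open>d\<close>
  would be a fixed combination of the values on \<open>C\<close>, and this combination would be a nonzero
  annihilator of \<open>W\<close>.\<close>

lemma interpolating_if_separating: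
  fixes W :: "('e \<Rightarrow> complex) set"
  assumes "finite C" and zero: "(\<lambda>_. 0) \<in> W"
    and add: "\<And>w w'. w \<in> W \<Longrightarrow> w' \<in> W \<Longrightarrow> (\<lambda>e. w e + w' e) \<in> W"
    and scale: "\<And>c w. w \<in> W \<Longrightarrow> (\<lambda>e. c * w e) \<in> W"
    and sep: "\<And>g. (\<And>w. w \<in> W \<Longrightarrow> (\<Sum>e\<in>C. g e * w e) = 0) \<Longrightarrow> \<forall>e\<in>C. g e = 0"
  shows "\<exists>w\<in>W. \<forall>e\<in>C. w e = v e"
  using \<open>finite C\<close> sep
proof (induction C arbitrary: v)
  case empty
  then show ?case using zero by blast
next
  case (insert d C)
  have IH: "\<exists>w\<in>W. \<forall>e\<in>C. w e = v e" for v
  proof (rule insert.IH)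
    fix g assume g: "\<And>w. w \<in> W \<Longrightarrow> (\<Sum>e\<in>C. g e * w e) = 0"
    have "\<forall>e\<in>insert d C. (g(d := 0)) e = 0"
    proof (rule insert.prems)
      fix w assume "w \<in> W"
      have "(\<Sum>e\<in>C. (g(d := 0)) e * w e) = (\<Sum>e\<in>C. g e * w e)"
        using insert.hyps by (intro sum.cong) auto
      then show "(\<Sum>e\<in>insert d C. (g(d := 0)) e * w e) = 0"
        using insert.hyps g[OF \<open>w \<in> W\<close>] by simp
    qed
    then show "\<forall>e\<in>C. g e = 0" using insert.hyps by (auto split: if_splits)
  qed
  have "\<exists>w\<in>W. (\<forall>e\<in>C. w e = 0) \<and> w d \<noteq> 0"
  proof (rule ccontr)
    assume no: "\<not> ?thesis"
    have "\<forall>a. \<exists>w\<in>W. \<forall>e\<in>C. w e = (if e = a then 1 else 0)" by (intro allI IH)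
    then obtain \<delta> where \<delta>: "\<And>a. \<delta> a \<in> W" "\<And>a e. e \<in> C \<Longrightarrow> \<delta> a e = (if e = a then 1 else 0)"
      by metis
    define g where "g e = (if e = d then -1 else \<delta> e d)" for e
    have comb: "(\<lambda>e. \<Sum>a\<in>A. x a * \<delta> a e) \<in> W" if "finite A" for x A
      using that
    proof (induction A)
      case (insert a A)
      then show ?case using add[OF scale[OF \<delta>(1)[of a], of "x a"] insert.IH] by simp
    qed (simp add: zero)
    have "\<forall>e\<in>insert d C. g e = 0"
    proof (rule insert.prems)
      fix w assume w: "w \<in> W"
      define w' where "w' = (\<lambda>e. w e + (-1) * (\<Sum>a\<in>C. w a * \<delta> a e))"
      have "w' \<in> W" unfolding w'_def by (intro add scale comb w insert.hyps)
      moreover have "\<forall>e\<in>C. w' e = 0"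
        using insert.hyps by (simp add: w'_def \<delta>(2) if_distrib[of "\<lambda>x. _ * x"] cong: if_cong)
      ultimately have "w' d = 0" using no by blast
      moreover have "(\<Sum>e\<in>C. g e * w e) = (\<Sum>a\<in>C. w a * \<delta> a d)"
        using insert.hyps by (intro sum.cong) (auto simp: g_def)
      ultimately show "(\<Sum>e\<in>insert d C. g e * w e) = 0"
        using insert.hyps by (simp add: w'_def g_def)
    qed
    then show False by (simp add: g_def)
  qed
  then obtain w0 where w0: "w0 \<in> W" "\<And>e. e \<in> C \<Longrightarrow> w0 e = 0" "w0 d \<noteq> 0" by blast
  obtain w where w: "w \<in> W" "\<And>e. e \<in> C \<Longrightarrow> w e = v e" using IH by blast
  have "(\<lambda>e. w e + ((v d - w d) / w0 d) * w0 e) \<in> W" by (intro add scale w w0)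
  then show ?case using w w0 by (intro bexI) auto
qed

text \<open>By duality each coefficient on \<open>C\<close> is a combination of the conditions, so the coefficients
  on \<open>C\<close> of a polynomial that satisfies all the conditions are bounded in terms of those
  outside \<open>C\<close>.\<close>

lemma determining_bound:
  assumes p: "determining p n C" and "finite C" and "finite E"
  shows "\<exists>K\<ge>0. \<forall>h. (\<forall>i<n. \<forall>q. quadratic q \<longrightarrow>
      (\<Sum>e\<in>C. h e * (q e * monom_at (p i) e)) + (\<Sum>e\<in>E. h e * (q e * monom_at (p i) e)) = 0) \<longrightarrow>
      (\<Sum>e\<in>C. norm (h e)) \<le> K * (\<Sum>e\<in>E. norm (h e))"
proof -
  define W where "W = {w. \<exists>q. (\<forall>i<n. quadratic (q i)) \<and>
      w = (\<lambda>e. \<Sum>i<n. q i e * monom_at (p i) e)}"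
  have "\<exists>w\<in>W. \<forall>e\<in>C. w e = (if e = d then 1 else 0)" for d
  proof (rule interpolating_if_separating[OF \<open>finite C\<close>])
    show "(\<lambda>_. 0) \<in> W"
      unfolding W_def using quadratic_zero by (auto intro!: exI[of _ "\<lambda>_ _. 0"])
    show "(\<lambda>e. w e + w' e) \<in> W" if ww: "w \<in> W" "w' \<in> W" for w w'
    proof -
      from ww obtain q q' where q: "\<forall>i<n. quadratic (q i)" "\<forall>i<n. quadratic (q' i)"
        "w = (\<lambda>e. \<Sum>i<n. q i e * monom_at (p i) e)" "w' = (\<lambda>e. \<Sum>i<n. q' i e * monom_at (p i) e)"
        unfolding W_def by blast
      then show ?thesis
        unfolding W_def by (intro CollectI exI[of _ "\<lambda>i e. q i e + q' i e"])
          (auto simp: quadratic_add sum.distrib algebra_simps)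
    qed
    show "(\<lambda>e. c * w e) \<in> W" if ww: "w \<in> W" for c w
    proof -
      from ww obtain q where q: "\<forall>i<n. quadratic (q i)"
        "w = (\<lambda>e. \<Sum>i<n. q i e * monom_at (p i) e)"
        unfolding W_def by blast
      then show ?thesis
        unfolding W_def by (intro CollectI exI[of _ "\<lambda>i e. c * q i e"])
          (auto simp: quadratic_cmult sum_distrib_left algebra_simps)
    qed
    fix g assume g: "\<And>w. w \<in> W \<Longrightarrow> (\<Sum>e\<in>C. g e * w e) = 0"
    have "(\<Sum>e\<in>C. g e * (q e * monom_at (p i) e)) = 0" if "i < n" "quadratic q" for i q
    proof (rule g)
      show "(\<lambda>e. q e * monom_at (p i) e) \<in> W"
        unfolding W_def using that quadratic_zero
        by (intro CollectI exI[of _ "\<lambda>j. if j = i then q else (\<lambda>_. 0)"])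
          (auto simp: if_distrib[of "\<lambda>f. f _"] if_distrib[of "\<lambda>x. x * _"] cong: if_cong)
    qed
    then show "\<forall>e\<in>C. g e = 0" using p unfolding determining_def by blast
  qed
  then obtain w where w: "\<And>d. w d \<in> W" "\<And>d e. e \<in> C \<Longrightarrow> w d e = (if e = d then 1 else 0)"
    by metis
  show ?thesis
  proof (intro exI[of _ "\<Sum>d\<in>C. \<Sum>e\<in>E. norm (w d e)"] conjI allI impI)
    show "0 \<le> (\<Sum>d\<in>C. \<Sum>e\<in>E. norm (w d e))" by (intro sum_nonneg) auto
    fix h assume h: "\<forall>i<n. \<forall>q. quadratic q \<longrightarrow>
      (\<Sum>e\<in>C. h e * (q e * monom_at (p i) e)) + (\<Sum>e\<in>E. h e * (q e * monom_at (p i) e)) = 0"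
    have "norm (h d) \<le> (\<Sum>e\<in>E. norm (w d e)) * (\<Sum>e\<in>E. norm (h e))" if "d \<in> C" for d
    proof -
      obtain q where q: "\<forall>i<n. quadratic (q i)" "w d = (\<lambda>e. \<Sum>i<n. q i e * monom_at (p i) e)"
        using w(1)[of d] unfolding W_def by blast
      have swap: "(\<Sum>e\<in>A. h e * w d e) = (\<Sum>i<n. \<Sum>e\<in>A. h e * (q i e * monom_at (p i) e))" for A
        unfolding q(2) sum_distrib_left by (rule sum.swap)
      have "(\<Sum>e\<in>C. h e * w d e) + (\<Sum>e\<in>E. h e * w d e) = 0"
        unfolding swap sum.distrib[symmetric] using h q(1) by simp
      moreover have "(\<Sum>e\<in>C. h e * w d e) = h d"
        using that \<open>finite C\<close> by (simp add: w(2) if_distrib[of "\<lambda>x. _ * x"] cong: if_cong)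
      ultimately have "h d = - (\<Sum>e\<in>E. h e * w d e)" by (simp add: eq_neg_iff_add_eq_0)
      then have "norm (h d) \<le> (\<Sum>e\<in>E. norm (h e * w d e))" by (simp add: norm_sum)
      also have "\<dots> \<le> (\<Sum>e\<in>E. norm (h e) * (\<Sum>e\<in>E. norm (w d e)))"
        unfolding norm_mult using \<open>finite E\<close> by (intro sum_mono mult_left_mono member_le_sum) auto
      finally show ?thesis by (simp add: sum_distrib_right mult.commute)
    qed
    then have "(\<Sum>d\<in>C. norm (h d)) \<le> (\<Sum>d\<in>C. (\<Sum>e\<in>E. norm (w d e)) * (\<Sum>e\<in>E. norm (h e)))"
      by (rule sum_mono)
    then show "(\<Sum>d\<in>C. norm (h d)) \<le> (\<Sum>d\<in>C. \<Sum>e\<in>E. norm (w d e)) * (\<Sum>e\<in>E. norm (h e))"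
      by (simp add: sum_distrib_right)
  qed
qed

text \<open>Let \<open>w\<close> be the affine function that is positive on \<open>C\<close> and at most
  \<open>0\<close> on \<open>E\<close>. Moving the points for \<open>C\<close> by the one-parameter
  subgroup \<open>t \<mapsto> (t\<^sup>\<alpha>, t\<^sup>\<beta>)\<close> multiplies, up to a common
  factor, the coefficient of exponent \<open>e\<close> by \<open>t\<close> to the power \<open>w
  e\<close>. The two bounds on the coefficients then contradict each other for large \<open>t\<close>,
  unless all coefficients vanish.\<close>

lemma determined_cut:
  assumes "determined n C" "determined m E"
    and CE: "\<And>e. e \<in> C \<Longrightarrow> \<alpha> * fst e + \<beta> * snd e > c" "\<And>e. e \<in> E \<Longrightarrow> \<alpha> * fst e + \<beta> * snd e \<le> c"
  shows "determined (n + m) (C \<union> E)"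
proof -
  obtain p r where p: "determining p n C" "finite C" and r: "determining r m E" "finite E"
    using assms(1,2) unfolding determined_def by blast
  obtain K where K: "K \<ge> 0" "\<And>h. (\<forall>i<n. \<forall>q. quadratic q \<longrightarrow>
      (\<Sum>e\<in>C. h e * (q e * monom_at (p i) e)) + (\<Sum>e\<in>E. h e * (q e * monom_at (p i) e)) = 0) \<Longrightarrow>
      (\<Sum>e\<in>C. norm (h e)) \<le> K * (\<Sum>e\<in>E. norm (h e))"
    using determining_bound[OF p r(2)] by blast
  obtain L where L: "L \<ge> 0" "\<And>h. (\<forall>i<m. \<forall>q. quadratic q \<longrightarrow>
      (\<Sum>e\<in>E. h e * (q e * monom_at (r i) e)) + (\<Sum>e\<in>C. h e * (q e * monom_at (r i) e)) = 0) \<Longrightarrow>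
      (\<Sum>e\<in>E. norm (h e)) \<le> L * (\<Sum>e\<in>C. norm (h e))"
    using determining_bound[OF r p(2)] by blast
  \<comment> \<open>Composed, the two estimates bound the coefficients on \<open>C\<close> by \<open>K L / t\<close> times themselves.\<close>
  define t where "t = K * L + 1"
  have t: "t \<ge> 1" "K * L < t" using K(1) L(1) by (auto simp: t_def)
  define T where "T = complex_of_real t"
  have T: "T \<noteq> 0" "norm T = t" using t by (auto simp: T_def)
  define s where "s i = (if i < n then (fst (p i) * T powi \<alpha>, snd (p i) * T powi \<beta>) else r (i - n))" for i
  define w where "w e = \<alpha> * fst e + \<beta> * snd e - c" for e :: "int \<times> int"
  have disj: "C \<inter> E = {}" using CE by force
  have s_mon: "monom_at (s i) e = T powi c * (T powi w e * monom_at (p i) e)" if "i < n" for i e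
    using that T(1)
    by (simp add: s_def w_def monom_at_def power_int_mult_distrib power_int_mult power_int_add
        power_int_diff)
  have "determining s (n + m) (C \<union> E)"
    unfolding determining_def
  proof (intro conjI allI impI)
    fix i
    show "fst (s i) \<noteq> 0" "snd (s i) \<noteq> 0"
      using p(1) r(1) T(1) unfolding determining_def s_def by auto
  next
    fix g assume g: "\<forall>i<n + m. \<forall>q. quadratic q \<longrightarrow>
      (\<Sum>e\<in>C \<union> E. g e * (q e * monom_at (s i) e)) = 0"
    \<comment> \<open>The coefficients as seen from the moved points: enlarged on \<open>C\<close>, diminished on \<open>E\<close>.\<close>
    define h where "h e = T powi w e * g e" for e
    have 1: "(\<Sum>e\<in>C. norm (h e)) \<le> K * (\<Sum>e\<in>E. norm (h e))"
    proof (intro K(2) allI impI)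
      fix i q assume i: "i < n" and q: "quadratic q"
      have "0 = (\<Sum>e\<in>C \<union> E. g e * (q e * monom_at (s i) e))" using g i q by simp
      also have "\<dots> = (\<Sum>e\<in>C \<union> E. T powi c * (h e * (q e * monom_at (p i) e)))"
        using i by (intro sum.cong) (simp_all add: s_mon h_def)
      also have "\<dots> = T powi c * ((\<Sum>e\<in>C. h e * (q e * monom_at (p i) e)) +
          (\<Sum>e\<in>E. h e * (q e * monom_at (p i) e)))"
        using p(2) r(2) disj by (simp add: sum_distrib_left sum.union_disjoint distrib_left)
      finally show "(\<Sum>e\<in>C. h e * (q e * monom_at (p i) e)) +
          (\<Sum>e\<in>E. h e * (q e * monom_at (p i) e)) = 0" using T(1) by simp
    qed
    have 2: "(\<Sum>e\<in>E. norm (g e)) \<le> L * (\<Sum>e\<in>C. norm (g e))"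
    proof (intro L(2) allI impI)
      fix i q assume i: "i < m" and q: "quadratic q"
      have "0 = (\<Sum>e\<in>C \<union> E. g e * (q e * monom_at (s (n + i)) e))" using g i q by simp
      also have "\<dots> = (\<Sum>e\<in>C \<union> E. g e * (q e * monom_at (r i) e))"
        by (simp add: s_def)
      finally show "(\<Sum>e\<in>E. g e * (q e * monom_at (r i) e)) +
          (\<Sum>e\<in>C. g e * (q e * monom_at (r i) e)) = 0"
        using p(2) r(2) disj by (simp add: sum.union_disjoint add.commute)
    qed
    have wC: "w e \<ge> 1" if "e \<in> C" for e using CE(1)[OF that] by (simp add: w_def)
    have wE: "w e \<le> 0" if "e \<in> E" for e using CE(2)[OF that] by (simp add: w_def)
    have 3: "(\<Sum>e\<in>C. norm (g e)) * t \<le> (\<Sum>e\<in>C. norm (h e))"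
      unfolding sum_distrib_right
    proof (rule sum_mono)
      fix e assume "e \<in> C"
      have "t powi 1 \<le> t powi w e" using t wC[OF \<open>e \<in> C\<close>] by (intro power_int_increasing) auto
      then have "norm (g e) * t \<le> norm (g e) * t powi w e" by (intro mult_left_mono) auto
      then show "norm (g e) * t \<le> norm (h e)"
        by (simp add: h_def norm_mult norm_power_int T mult.commute)
    qed
    have 4: "(\<Sum>e\<in>E. norm (h e)) \<le> (\<Sum>e\<in>E. norm (g e))"
    proof (rule sum_mono)
      fix e assume "e \<in> E"
      have "t powi w e \<le> t powi 0" using t wE[OF \<open>e \<in> E\<close>] by (intro power_int_increasing) auto
      then have "t powi w e * norm (g e) \<le> 1 * norm (g e)" by (intro mult_right_mono) auto
      then show "norm (h e) \<le> norm (g e)"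
        by (simp add: h_def norm_mult norm_power_int T)
    qed
    define S where "S = (\<Sum>e\<in>C. norm (g e))"
    have S0: "S \<ge> 0" by (auto simp: S_def intro: sum_nonneg)
    have "S * t \<le> K * (\<Sum>e\<in>E. norm (g e))"
      using 1 3 4 K(1) unfolding S_def by (meson mult_left_mono order_trans)
    also have "\<dots> \<le> K * (L * S)" using 2 K(1) unfolding S_def by (rule mult_left_mono)
    finally have "S * (t - K * L) \<le> 0" by (simp add: algebra_simps)
    then have "S = 0" using t(2) S0 by (simp add: mult_le_0_iff)
    then have gC: "g e = 0" if "e \<in> C" for e
      using that p(2) by (simp add: S_def sum_nonneg_eq_0_iff)
    have "(\<Sum>e\<in>E. norm (g e)) \<le> 0" using 2 gC by simp
    then have "(\<Sum>e\<in>E. norm (g e)) = 0" by (simp add: order_antisym sum_nonneg)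
    then have "g e = 0" if "e \<in> E" for e
      using that r(2) by (simp add: sum_nonneg_eq_0_iff)
    with gC show "\<forall>e\<in>C \<union> E. g e = 0" by blast
  qed
  then show ?thesis unfolding determined_def using p(2) r(2) by blast
qed

lemma determined_empty: "determined n {}"
  unfolding determined_def determining_def by (intro conjI exI[of _ "\<lambda>_. (1, 1)"]) auto

lemma determiningD:
  assumes "determining p n C"
    and "\<And>i q. i < n \<Longrightarrow> quadratic q \<Longrightarrow> (\<Sum>e\<in>C. g e * (q e * monom_at (p i) e)) = 0"
  shows "\<forall>e\<in>C. g e = 0"
  using assms unfolding determining_def by blast

lemma sum_eq_single:
  assumes "finite C" "d \<in> C" "\<And>e. e \<in> C \<Longrightarrow> e \<noteq> d \<Longrightarrow> f e = (0::complex)"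
  shows "sum f C = f d"
  using sum.remove[OF assms(1,2), of f] sum.neutral[of "C - {d}" f] assms(3) by simp

definition isolated_by_line :: "(int \<times> int) set \<Rightarrow> int \<times> int \<Rightarrow> bool" where
  "isolated_by_line S d \<longleftrightarrow> (\<exists>a b k. a * fst d + b * snd d + k \<noteq> 0 \<and>
     (\<forall>e\<in>S. e \<noteq> d \<longrightarrow> a * fst e + b * snd e + k = 0))"

fun noncollinear :: "(int \<times> int) list \<Rightarrow> bool" where
  "noncollinear [(u, v), (u', v'), (u'', v'')] \<longleftrightarrow> (u' - u) * (v'' - v) \<noteq> (u'' - u) * (v' - v)"
| "noncollinear es \<longleftrightarrow> length es \<le> 2"

lemma isolated_pair: "isolated_by_line {d, e} d"
proof -
  consider "d = e" | "d \<noteq> e" "fst d = fst e" | "fst d \<noteq> fst e" by blast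
  then show ?thesis
  proof cases
    case 1
    then show ?thesis unfolding isolated_by_line_def
      by (intro exI[of _ 0] exI[of _ 1]) auto
  next
    case 2
    then show ?thesis unfolding isolated_by_line_def
      by (intro exI[of _ 0] exI[of _ 1] exI[of _ "- snd e"]) (auto simp: prod_eq_iff)
  next
    case 3
    then show ?thesis unfolding isolated_by_line_def
      by (intro exI[of _ 1] exI[of _ 0] exI[of _ "- fst e"]) auto
  qed
qed

lemma isolated_by_lineI:
  assumes "a * fst d + b * snd d + k \<noteq> 0"
    and "\<And>e. e \<in> S \<Longrightarrow> e \<noteq> d \<Longrightarrow> a * fst e + b * snd e + k = 0"
  shows "isolated_by_line S d"
  using assms unfolding isolated_by_line_def by blast

lemma isolated_subset: "isolated_by_line S d \<Longrightarrow> T \<subseteq> S \<Longrightarrow> isolated_by_line T d"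
  unfolding isolated_by_line_def by blast

lemma isolated_if_noncollinear:
  assumes "noncollinear es" "d \<in> set es"
  shows "isolated_by_line (set es) d"
proof (cases "length es \<le> 2")
  case True
  have "\<exists>e. set es \<subseteq> {d, e}"
  proof -
    consider x where "es = [x]" | x y where "es = [x, y]"
      using True assms(2) by (cases es; cases "tl es"; cases "tl (tl es)") auto
    then show ?thesis using assms(2) by cases auto
  qed
  then show ?thesis using isolated_pair isolated_subset by blast
next
  case False
  then obtain u v u' v' u'' v'' where es: "es = [(u, v), (u', v'), (u'', v'')]"
    using assms(1) by (cases es rule: noncollinear.cases) auto
  have nz: "(u' - u) * (v'' - v) - (u'' - u) * (v' - v) \<noteq> 0" using assms(1) by (simp add: es)
  consider "d = (u, v)" | "d = (u', v')" | "d = (u'', v'')" using assms(2) by (auto simp: es)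
  then show ?thesis
  proof cases
    case 1
    show ?thesis
      by (rule isolated_by_lineI[of "v'' - v'" _ "u' - u''" "u'' * v' - u' * v''"])
        (use nz in \<open>auto simp: 1 es algebra_simps\<close>)
  next
    case 2
    show ?thesis
      by (rule isolated_by_lineI[of "v'' - v" _ "u - u''" "u'' * v - u * v''"])
        (use nz in \<open>auto simp: 2 es algebra_simps\<close>)
  next
    case 3
    show ?thesis
      by (rule isolated_by_lineI[of "v' - v" _ "u - u'" "u' * v - u * v'"])
        (use nz in \<open>auto simp: 3 es algebra_simps\<close>)
  qed
qed

text \<open>The sets in question lie on no conic: a conic through three points of a line contains the line, and the
  remaining points would lie on a second line. The proof kills the coefficients off the line first, with
  the product of the given line and a line through the other points off it, and then those on the line,
  with products of two affine forms.\<close>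

lemma determined_leaf:
  assumes "finite C"
    and on: "card {e \<in> C. l * fst e + m * snd e = n} \<le> 3"
    and off: "{e \<in> C. l * fst e + m * snd e \<noteq> n} = set es" "noncollinear es"
  shows "determined 1 C"
proof -
  have "g d = 0"
    if g: "\<forall>q. quadratic q \<longrightarrow> (\<Sum>e\<in>C. g e * q e) = 0" and "d \<in> C" for g d
  proof -
    have product: "g d = 0" if "a * fst d + b * snd d + k \<noteq> 0" "a' * fst d + b' * snd d + k' \<noteq> 0"
      "\<And>e. e \<in> C \<Longrightarrow> e \<noteq> d \<Longrightarrow> g e = 0 \<or> a * fst e + b * snd e + k = 0 \<or> a' * fst e + b' * snd e + k' = 0"
      "d \<in> C" for a b k a' b' k' d
    proof -
      let ?q = "\<lambda>e. of_int ((a * fst e + b * snd e + k) * (a' * fst e + b' * snd e + k')) :: complex"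
      have "(\<Sum>e\<in>C. g e * ?q e) = g d * ?q d"
      proof (rule sum_eq_single[OF assms(1) \<open>d \<in> C\<close>])
        fix e assume e: "e \<in> C" "e \<noteq> d"
        have "g e = 0 \<or> (a * fst e + b * snd e + k) * (a' * fst e + b' * snd e + k') = 0"
          using that(3)[OF e] unfolding mult_eq_0_iff by blast
        then show "g e * ?q e = 0" by (elim disjE) (simp_all only: of_int_0 mult_zero_left mult_zero_right)
      qed
      moreover have "(\<Sum>e\<in>C. g e * ?q e) = 0" by (rule g[rule_format], rule quadratic_mult_affine)
      ultimately have "g d * ?q d = 0" by (rule trans[OF sym])
      then show ?thesis using that(1,2) unfolding mult_eq_0_iff of_int_eq_0_iff by blast
    qed
    have g_off: "g d = 0" if d: "d \<in> C" "l * fst d + m * snd d \<noteq> n" for d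
    proof -
      obtain a b k where *: "a * fst d + b * snd d + k \<noteq> 0"
        "\<And>e. e \<in> set es \<Longrightarrow> e \<noteq> d \<Longrightarrow> a * fst e + b * snd e + k = 0"
        using isolated_if_noncollinear[OF off(2), of d] d off(1) unfolding isolated_by_line_def by blast
      show ?thesis
        by (rule product[of l d m "-n" a b k])
          (use * d off(1) in auto)
    qed
    show ?thesis
    proof (cases "l * fst d + m * snd d = n")
      case True
      let ?S = "{e \<in> C. l * fst e + m * snd e = n} - {d}"
      have "card ?S \<le> 2" using on True \<open>d \<in> C\<close> assms(1) by (simp add: card_Diff_singleton_if)
      moreover have "finite ?S" using assms(1) by simp
      ultimately have "\<exists>x y. ?S \<subseteq> {x, y}"
      proof (cases "?S = {}")
        case False
        then obtain x where x: "x \<in> ?S" by blast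
        then have "card (?S - {x}) \<le> Suc 0"
          using \<open>card ?S \<le> 2\<close> \<open>finite ?S\<close> by (subst card_Diff_singleton) auto
        then have "\<exists>y. ?S - {x} \<subseteq> {y}"
          using card_le_Suc0_iff_eq[of "?S - {x}"] \<open>finite ?S\<close> by blast
        then show ?thesis by blast
      qed blast
      then obtain x y where xy: "?S \<subseteq> {x, y}" by blast
      \<comment> \<open>If fewer than three points lie on the line, \<open>x\<close> or \<open>y\<close> may be \<open>d\<close>; it is then replaced by a
        neighbour, since the affine forms below must not vanish at \<open>d\<close>.\<close>
      define x' where "x' = (if x = d then (fst d + 1, snd d) else x)"
      define y' where "y' = (if y = d then (fst d + 1, snd d) else y)"
      have xy': "x' \<noteq> d" "y' \<noteq> d" "?S \<subseteq> {x', y'}"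
        using xy by (auto simp: x'_def y'_def prod_eq_iff)
      obtain a b k where 1: "a * fst d + b * snd d + k \<noteq> 0" "a * fst x' + b * snd x' + k = 0"
        using isolated_pair[of d x'] xy' unfolding isolated_by_line_def by auto
      obtain a' b' k' where 2: "a' * fst d + b' * snd d + k' \<noteq> 0" "a' * fst y' + b' * snd y' + k' = 0"
        using isolated_pair[of d y'] xy' unfolding isolated_by_line_def by auto
      show ?thesis
      proof (rule product[OF 1(1) 2(1) _ \<open>d \<in> C\<close>])
        fix e assume e: "e \<in> C" "e \<noteq> d"
        show "g e = 0 \<or> a * fst e + b * snd e + k = 0 \<or> a' * fst e + b' * snd e + k' = 0"
        proof (cases "l * fst e + m * snd e = n")
          case True
          then have "e = x' \<or> e = y'" using e xy'(3) by blast
          then show ?thesis using 1 2 by blast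
        qed (use g_off e in blast)
      qed
    qed (use g_off \<open>d \<in> C\<close> in blast)
  qed
  then show ?thesis
    unfolding determined_def determining_def
    by (intro conjI exI[of _ "\<lambda>_. (1, 1)"]) (auto simp: assms(1) monom_at_def)
qed

text \<open>Translating the support multiplies the polynomial by a monomial, which does not vanish on the torus.\<close>

lemma determined_shift:
  assumes "determined n C"
  shows "determined n ((\<lambda>e. (fst e + x, snd e + y)) ` C)"
proof -
  let ?f = "\<lambda>e::int\<times>int. (fst e + x, snd e + y)"
  obtain p where p: "determining p n C" "finite C" using assms unfolding determined_def by blast
  have nz: "fst (p i) \<noteq> 0" "snd (p i) \<noteq> 0" for i using p(1) unfolding determining_def by auto
  have "determining p n (?f ` C)"
    unfolding determining_def
  proof (intro conjI allI impI nz)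
    fix g assume g: "\<forall>i<n. \<forall>q. quadratic q \<longrightarrow> (\<Sum>e\<in>?f ` C. g e * (q e * monom_at (p i) e)) = 0"
    have "\<forall>e\<in>C. g (?f e) = 0"
    proof (rule determiningD[OF p(1)])
      fix i q assume i: "i < n" and q: "quadratic q"
      have "0 = (\<Sum>e\<in>?f ` C. g e * ((\<lambda>(u, v). q (u + (-x), v + (-y))) e * monom_at (p i) e))"
        by (rule sym, rule g[rule_format, OF i quadratic_shift[OF q]])
      also have "\<dots> = (\<Sum>e\<in>C. monom_at (p i) (x, y) * (g (?f e) * (q e * monom_at (p i) e)))"
        by (subst sum.reindex) (auto simp: inj_on_def monom_at_def power_int_add nz intro!: sum.cong)
      also have "\<dots> = monom_at (p i) (x, y) * (\<Sum>e\<in>C. g (?f e) * (q e * monom_at (p i) e))"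
        by (simp add: sum_distrib_left)
      finally show "(\<Sum>e\<in>C. g (?f e) * (q e * monom_at (p i) e)) = 0"
        by (auto simp: monom_at_def nz)
    qed
    then show "\<forall>e\<in>?f ` C. g e = 0" by blast
  qed
  then show ?thesis using p(2) unfolding determined_def by blast
qed

lemma determined_swap:
  assumes "determined n C"
  shows "determined n (prod.swap ` C)"
proof -
  obtain p where p: "determining p n C" "finite C" using assms unfolding determined_def by blast
  have nz: "fst (p i) \<noteq> 0" "snd (p i) \<noteq> 0" for i using p(1) unfolding determining_def by auto
  have "determining (prod.swap \<circ> p) n (prod.swap ` C)"
    unfolding determining_def
  proof (intro conjI allI impI)
    fix g assume g: "\<forall>i<n. \<forall>q. quadratic q \<longrightarrow>
      (\<Sum>e\<in>prod.swap ` C. g e * (q e * monom_at ((prod.swap \<circ> p) i) e)) = 0"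
    have "\<forall>e\<in>C. g (prod.swap e) = 0"
    proof (rule determiningD[OF p(1)])
      fix i q assume i: "i < n" and q: "quadratic q"
      have "0 = (\<Sum>e\<in>prod.swap ` C. g e * ((\<lambda>(u, v). q (v, u)) e * monom_at ((prod.swap \<circ> p) i) e))"
        by (rule sym, rule g[rule_format, OF i quadratic_swap[OF q]])
      also have "\<dots> = (\<Sum>e\<in>C. g (prod.swap e) * (q e * monom_at (p i) e))"
        by (subst sum.reindex) (auto simp: monom_at_def intro!: sum.cong)
      finally show "(\<Sum>e\<in>C. g (prod.swap e) * (q e * monom_at (p i) e)) = 0" by simp
    qed
    then show "\<forall>e\<in>prod.swap ` C. g e = 0" by blast
  qed (simp_all add: nz)
  then show ?thesis using p(2) unfolding determined_def by blast
qed

section \<open>Lattice rectangles cut into six-point pieces\<close>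

text \<open>For every number \<open>s\<close> of points some part of \<open>D\<close> with \<open>f s\<close>
  elements is determined, that is, suitable \<open>s\<close> triple points impose at least \<open>f
  s\<close> conditions on the polynomials with support in \<open>D\<close>.\<close>

definition fills :: "(int \<times> int) set \<Rightarrow> (nat \<Rightarrow> nat) \<Rightarrow> bool" where
  "fills D f \<longleftrightarrow> (\<forall>s. \<exists>C\<subseteq>D. card C = f s \<and> determined s C)"

text \<open>The largest conceivable rank if each point imposes at most \<open>m\<close> conditions: \<open>m =
  6\<close> is the generic case, \<open>m = 5\<close> that of two rows or columns and \<open>m =
  3\<close> that of one.\<close>

definition spread :: "nat \<Rightarrow> (int \<times> int) set \<Rightarrow> bool" where
  "spread m D \<longleftrightarrow> fills D (\<lambda>s. min (card D) (m * s))"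

definition rect :: "nat \<Rightarrow> nat \<Rightarrow> (int \<times> int) set" where
  "rect A B = {0..<int A} \<times> {0..<int B}"

lemma card_rect: "card (rect A B) = A * B"
  by (simp add: rect_def card_cartesian_product)

lemma fills_image:
  assumes "fills D f" "inj_on h D" "\<And>n C. determined n C \<Longrightarrow> determined n (h ` C)"
  shows "fills (h ` D) f"
  unfolding fills_def
proof
  fix s
  obtain C where "C \<subseteq> D" "card C = f s" "determined s C" using assms(1) unfolding fills_def by blast
  then show "\<exists>C\<subseteq>h ` D. card C = f s \<and> determined s C"
    using assms(2,3) by (intro exI[of _ "h ` C"]) (auto simp: card_image inj_on_subset)
qed

lemma fills_swap: "fills (rect A B) f \<Longrightarrow> fills (rect B A) f"
  using fills_image[of "rect A B" f prod.swap] determined_swap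
  by (auto simp: rect_def product_swap)

lemma spread_swap: "spread m (rect A B) \<Longrightarrow> spread m (rect B A)"
  unfolding spread_def using fills_swap by (simp add: card_rect mult.commute)

text \<open>The vertical line between the two rectangles is a cut; the first \<open>n\<close> points are spent on the
  left rectangle, which they fill exactly.\<close>

lemma fills_beside:
  assumes "spread m (rect A B)" "A * B = m * n" "fills (rect A' B) f"
  shows "fills (rect (A + A') B) (\<lambda>s. if s \<le> n then m * s else A * B + f (s - n))"
  unfolding fills_def
proof
  fix s
  let ?h = "\<lambda>e::int\<times>int. (fst e + int A, snd e + 0)"
  have 1: "\<exists>C\<subseteq>rect A B. card C = min (A * B) (m * s) \<and> determined s C" for s
    using assms(1) unfolding spread_def fills_def card_rect by blast
  have sub: "rect A B \<subseteq> rect (A + A') B" by (auto simp: rect_def)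
  show "\<exists>C\<subseteq>rect (A + A') B. card C = (if s \<le> n then m * s else A * B + f (s - n)) \<and> determined s C"
  proof (cases "s \<le> n")
    case True
    then have "min (A * B) (m * s) = m * s" using assms(2) by simp
    then obtain C where "C \<subseteq> rect A B" "card C = m * s" "determined s C" using 1[of s] by auto
    then show ?thesis using True sub by (intro exI[of _ C]) auto
  next
    case False
    obtain C where C: "C \<subseteq> rect A B" "card C = A * B" "determined n C"
      using 1[of n] assms(2) by auto
    obtain E where E: "E \<subseteq> rect A' B" "card E = f (s - n)" "determined (s - n) E"
      using assms(3) unfolding fills_def by blast
    have h: "?h ` E \<subseteq> {int A..<int (A + A')} \<times> {0..<int B}"
      using E(1) by (auto simp: rect_def)
    have "determined (n + (s - n)) (C \<union> ?h ` E)"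
      by (rule determined_cut[OF C(3) determined_shift[OF E(3)], where \<alpha> = "-1" and \<beta> = 0 and c = "- int A"])
        (use C(1) h in \<open>auto simp: rect_def\<close>)
    moreover have "C \<inter> ?h ` E = {}"
    proof -
      have "fst e < int A" if "e \<in> C" for e using that C(1) by (auto simp: rect_def)
      moreover have "\<not> fst e < int A" if "e \<in> ?h ` E" for e using that h by fastforce
      ultimately show ?thesis by blast
    qed
    then have "card (C \<union> ?h ` E) = card C + card (?h ` E)"
      using C(3) E(3) by (intro card_Un_disjoint) (auto simp: determined_def)
    moreover have "card (?h ` E) = card E" by (intro card_image) (auto simp: inj_on_def)
    moreover have "C \<union> ?h ` E \<subseteq> rect (A + A') B"
      using C(1) h sub by (fastforce simp: rect_def)
    ultimately show ?thesis using False C E by (intro exI[of _ "C \<union> ?h ` E"]) auto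
  qed
qed

lemma spread_beside:
  assumes "spread m (rect A B)" "m dvd A * B" "spread m (rect A' B)"
  shows "spread m (rect (A + A') B)"
proof -
  obtain n where n: "A * B = m * n" using assms(2) by (elim dvdE)
  let ?f = "\<lambda>s. if s \<le> n then m * s else A * B + min (A' * B) (m * (s - n))"
  have "fills (rect (A + A') B) ?f"
    by (rule fills_beside[OF assms(1) n assms(3)[unfolded spread_def card_rect]])
  moreover have "?f = (\<lambda>s. min ((A + A') * B) (m * s))"
  proof
    fix s
    show "?f s = min ((A + A') * B) (m * s)"
    proof (cases "s \<le> n")
      case True
      then have "m * s \<le> A * B" unfolding n by (rule mult_le_mono2)
      then have "m * s \<le> (A + A') * B" by (simp add: add_mult_distrib)
      then show ?thesis using True by (simp add: min_absorb2)
    next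
      case False
      then have "m * s = A * B + m * (s - n)" by (simp add: n diff_mult_distrib2)
      then show ?thesis using False by (simp add: add_mult_distrib)
    qed
  qed
  ultimately show ?thesis by (simp only: spread_def card_rect)
qed

text \<open>Executable certificates for successive cuts. One cut removes the \<open>k\<close> points of a half-plane
  and checks the hypotheses of \<open>determined_leaf\<close> for them.\<close>

definition peel_step :: "int \<times> int \<times> int \<times> int \<times> int \<times> int \<Rightarrow> nat \<Rightarrow> (int \<times> int) list \<Rightarrow> bool" where
  "peel_step = (\<lambda>(p, q, c, l, m, n) k D.
     let B = filter (\<lambda>(u, v). p * u + q * v > c) D
     in length B = k \<and> length (filter (\<lambda>(u, v). l * u + m * v = n) B) \<le> 3 \<and>
        noncollinear (filter (\<lambda>(u, v). l * u + m * v \<noteq> n) B))"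

definition peel_rest :: "int \<times> int \<times> int \<times> int \<times> int \<times> int \<Rightarrow> (int \<times> int) list \<Rightarrow> (int \<times> int) list" where
  "peel_rest = (\<lambda>(p, q, c, _) D. filter (\<lambda>(u, v). p * u + q * v \<le> c) D)"

fun peels where
  "peels D [] [] \<longleftrightarrow> True"
| "peels D (c # cs) (k # ns) \<longleftrightarrow> peel_step c k D \<and> peels (peel_rest c D) cs ns"
| "peels D _ _ \<longleftrightarrow> False"

lemma fills_peels:
  assumes "peels D cs ns" "distinct D"
  shows "fills (set D) (\<lambda>s. sum_list (take s ns))"
  using assms
proof (induction D cs ns rule: peels.induct)
  case (1 D)
  then show ?case unfolding fills_def using determined_empty by auto
next
  case (2 D cut cs k ns)
  obtain p q c l m n where cut: "cut = (p, q, c, l, m, n)" by (cases cut) auto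
  define B where "B = filter (\<lambda>(u, v). p * u + q * v > c) D"
  define R where "R = filter (\<lambda>(u, v). p * u + q * v \<le> c) D"
  define on where "on = filter (\<lambda>(u, v). l * u + m * v = n) B"
  define off where "off = filter (\<lambda>(u, v). l * u + m * v \<noteq> n) B"
  have *: "length B = k" "length on \<le> 3" "noncollinear off"
    using "2.prems"(1) by (simp_all add: cut peel_step_def Let_def B_def on_def off_def)
  have R: "peel_rest cut D = R" by (simp add: peel_rest_def cut R_def)
  have IH: "fills (set R) (\<lambda>s. sum_list (take s ns))"
    using "2.IH" "2.prems" unfolding R peels.simps by (simp add: R_def)
  have dB: "distinct B" "distinct on" using "2.prems"(2) by (auto simp: B_def on_def)
  have B1: "determined 1 (set B)"
  proof (rule determined_leaf)
    have "{e \<in> set B. l * fst e + m * snd e = n} = set on" by (auto simp: on_def)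
    then show "card {e \<in> set B. l * fst e + m * snd e = n} \<le> 3"
      using *(2) dB(2) by (simp add: distinct_card)
    show "{e \<in> set B. l * fst e + m * snd e \<noteq> n} = set off" by (auto simp: off_def)
  qed (use * in auto)
  show ?case
    unfolding fills_def
  proof
    fix s
    show "\<exists>C\<subseteq>set D. card C = sum_list (take s (k # ns)) \<and> determined s C"
    proof (cases s)
      case 0
      then show ?thesis using determined_empty by auto
    next
      case (Suc s')
      obtain C where C: "C \<subseteq> set R" "card C = sum_list (take s' ns)" "determined s' C"
        using IH unfolding fills_def by blast
      have "determined (1 + s') (set B \<union> C)"
        by (rule determined_cut[OF B1 C(3), where \<alpha> = p and \<beta> = q and c = c])
          (use C(1) in \<open>auto simp: B_def R_def\<close>)
      moreover have "card (set B \<union> C) = card (set B) + card C"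
        using C(1,3) by (intro card_Un_disjoint) (auto simp: determined_def B_def R_def)
      moreover have "set B \<union> C \<subseteq> set D" using C(1) by (auto simp: B_def R_def)
      ultimately show ?thesis
        using Suc C(2) *(1) dB(1) by (intro exI[of _ "set B \<union> C"]) (auto simp: distinct_card)
    qed
  qed
qed auto

definition rect_list :: "nat \<Rightarrow> nat \<Rightarrow> (int \<times> int) list" where
  "rect_list A B = List.product [0..int A - 1] [0..int B - 1]"

lemma fills_if_peels:
  assumes "peels (rect_list A B) cs ns"
  shows "fills (rect A B) (\<lambda>s. sum_list (take s ns))"
proof -
  have "distinct (rect_list A B)" by (simp add: rect_list_def distinct_product)
  moreover have "set (rect_list A B) = rect A B"
    by (auto simp: rect_list_def rect_def)
  ultimately show ?thesis using fills_peels[OF assms] by simp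
qed

text \<open>If each cut but the last removes \<open>m\<close> points and the last removes the remaining
  \<open>r\<close>, then any number of points fills as much as possible.\<close>

lemma spread_if_peels:
  assumes "peels (rect_list A B) cs (replicate k m @ [r])" "A * B = k * m + r" "r \<le> m"
  shows "spread m (rect A B)"
proof -
  have "sum_list (take s (replicate k m @ [r])) = min (k * m + r) (m * s)" for s
  proof (cases "s \<le> k")
    case True
    then have "m * s \<le> k * m + r" by (metis mult.commute mult_le_mono1 trans_le_add1)
    then have "min (k * m + r) (m * s) = m * s" by (rule min_absorb2)
    then show ?thesis using True by (simp add: sum_list_replicate mult.commute)
  next
    case False
    then have "m * (k + 1) \<le> m * s" by (intro mult_le_mono2) simp
    then have "k * m + r \<le> m * s" using assms(3) by (simp add: mult.commute)
    then have "min (k * m + r) (m * s) = k * m + r" by (rule min_absorb1)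
    then show ?thesis using False by (simp add: sum_list_replicate)
  qed
  then show ?thesis
    using fills_if_peels[OF assms(1)] assms(2) by (simp add: spread_def card_rect)
qed

section \<open>Explicit partitions of small rectangles\<close>

text \<open>A tuple \<open>(p, q, c, l, m, n)\<close> cuts off the points with \<open>p u + q v > c\<close>; among these at most three
  lie on the line \<open>l u + m v = n\<close>, and the others are not collinear.  The tuple \<open>(0, 0, -1, \<dots>)\<close> takes
  all the points that are left.\<close>

lemma spread_5_rect_1_2: "spread 5 (rect 1 2)"
  by (rule spread_if_peels[where k = 0 and r = 2 and cs =
     "[(0,0,-1,1,0,0)]"]) code_simp+

lemma spread_5_rect_2_2: "spread 5 (rect 2 2)"
  by (rule spread_if_peels[where k = 0 and r = 4 and cs =
     "[(0,0,-1,1,0,0)]"]) code_simp+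

lemma spread_5_rect_3_2: "spread 5 (rect 3 2)"
  by (rule spread_if_peels[where k = 1 and r = 1 and cs =
     "[(1,1,0,0,1,1), (0,0,-1,1,0,0)]"]) code_simp+

lemma spread_5_rect_4_2: "spread 5 (rect 4 2)"
  by (rule spread_if_peels[where k = 1 and r = 3 and cs =
     "[(1,1,1,0,1,1), (0,0,-1,1,0,0)]"]) code_simp+

lemma spread_5_rect_5_2: "spread 5 (rect 5 2)"
  by (rule spread_if_peels[where k = 1 and r = 5 and cs =
     "[(-1,-1,-3,1,0,0), (0,0,-1,0,1,1)]"]) code_simp+

lemma spread_5_rect_2_3: "spread 5 (rect 2 3)"
  by (rule spread_if_peels[where k = 1 and r = 1 and cs =
     "[(1,-1,-2,0,1,0), (0,0,-1,1,0,0)]"]) code_simp+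

lemma spread_3_rect_1_4: "spread 3 (rect 1 4)"
  by (rule spread_if_peels[where k = 1 and r = 1 and cs =
     "[(-1,1,0,1,0,0), (0,0,-1,1,0,0)]"]) code_simp+

lemma spread_5_rect_2_4: "spread 5 (rect 2 4)"
  by (rule spread_if_peels[where k = 1 and r = 3 and cs =
     "[(1,-1,-2,0,1,0), (0,0,-1,1,0,0)]"]) code_simp+

lemma spread_6_rect_1_3: "spread 6 (rect 1 3)"
  by (rule spread_if_peels[where k = 0 and r = 3 and cs =
     "[(0,0,-1,1,0,0)]"]) code_simp+

lemma spread_6_rect_3_3: "spread 6 (rect 3 3)"
  by (rule spread_if_peels[where k = 1 and r = 3 and cs =
     "[(1,-1,-1,0,1,0), (0,0,-1,1,0,0)]"]) code_simp+

lemma spread_6_rect_4_3: "spread 6 (rect 4 3)"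
  by (rule spread_if_peels[where k = 1 and r = 6 and cs =
     "[(1,-1,0,0,1,0), (0,0,-1,1,0,0)]"]) code_simp+

lemma spread_6_rect_5_5: "spread 6 (rect 5 5)"
  by (rule spread_if_peels[where k = 4 and r = 1 and cs =
     "[(-1,1,1,1,0,0), (1,-1,1,0,1,0), (-1,-1,-4,0,1,1), (1,1,4,0,1,3), (0,0,-1,1,0,2)]"]) code_simp+

lemma spread_6_rect_7_5: "spread 6 (rect 7 5)"
  by (rule spread_if_peels[where k = 5 and r = 5 and cs =
     "[(-1,1,1,1,0,0), (-1,2,2,0,1,4), (1,-1,3,0,1,0), (1,1,5,0,1,3), (1,1,2,0,1,1), (0,0,-1,1,0,0)]"]) code_simp+

lemma spread_6_rect_8_5: "spread 6 (rect 8 5)"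
  by (rule spread_if_peels[where k = 6 and r = 4 and cs =
     "[(-1,1,1,1,0,0), (-2,-1,-5,0,1,0), (1,1,8,0,1,4), (-1,2,1,0,1,3), (2,-1,9,0,1,0),
      (-2,-1,-10,0,1,1), (0,0,-1,0,1,2)]"]) code_simp+

lemma spread_6_rect_9_5: "spread 6 (rect 9 5)"
  by (rule spread_if_peels[where k = 7 and r = 3 and cs =
     "[(1,1,9,0,1,4), (-1,-1,-3,1,0,0), (-2,1,-1,1,0,1), (1,2,10,0,1,4), (-1,1,-2,1,0,2),
      (2,1,12,0,1,1), (-1,2,-4,0,1,1), (0,0,-1,0,1,0)]"]) code_simp+

lemma spread_6_rect_10_5: "spread 6 (rect 10 5)"
  by (rule spread_if_peels[where k = 8 and r = 2 and cs =
     "[(-1,-1,-3,1,0,0), (1,-1,6,0,1,0), (-2,1,-1,1,0,1), (1,-2,3,0,1,0), (2,-1,10,0,1,3),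
      (2,-1,7,1,0,6), (-1,-2,-8,0,1,1), (1,-1,-1,0,1,3), (0,0,-1,1,-1,-1)]"]) code_simp+

lemma spread_6_rect_11_5: "spread 6 (rect 11 5)"
  by (rule spread_if_peels[where k = 9 and r = 1 and cs =
     "[(-1,1,1,1,0,0), (-1,2,2,0,1,4), (1,1,11,0,1,4), (-2,1,-4,0,1,1), (-2,-1,-10,0,1,0),
      (-2,-1,-13,1,0,5), (-2,-1,-16,1,0,6), (2,-1,15,0,1,0), (-1,-2,-15,1,0,8), (0,0,-1,1,0,7)]"]) code_simp+

lemma spread_6_rect_12_5: "spread 6 (rect 12 5)"
  by (rule spread_if_peels[where k = 9 and r = 6 and cs =
     "[(-1,-1,-3,1,0,0), (1,1,12,0,1,4), (-1,-2,-6,0,1,0), (-2,-1,-8,0,1,3), (-2,-1,-11,1,0,3),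
      (1,2,13,0,1,4), (-1,1,-4,0,1,3), (-2,-1,-16,0,1,1), (2,1,18,0,1,1), (0,0,-1,1,0,8)]"]) code_simp+

lemma spread_6_rect_13_5: "spread 6 (rect 13 5)"
  by (rule spread_if_peels[where k = 10 and r = 5 and cs =
     "[(1,-1,9,0,1,0), (1,-2,6,0,1,0), (-1,-1,-3,1,0,0), (-2,1,-1,1,0,1), (2,-1,16,0,1,3),
      (2,1,18,0,1,4), (2,1,15,1,0,7), (2,1,12,1,0,6), (-1,2,1,0,1,3), (1,2,5,0,1,2),
      (0,0,-1,0,1,0)]"]) code_simp+

lemma spread_6_rect_14_5: "spread 6 (rect 14 5)"
  by (rule spread_if_peels[where k = 11 and r = 4 and cs =
     "[(1,1,14,0,1,4), (-1,-1,-3,1,0,0), (-2,1,-1,1,0,1), (1,2,15,0,1,4), (2,1,22,0,1,1),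
      (2,1,19,1,0,10), (2,-1,13,0,1,0), (2,-1,10,1,0,7), (1,-2,1,0,1,0), (1,0,4,0,1,4),
      (1,2,7,0,1,3), (0,0,-1,0,1,1)]"]) code_simp+

lemma spread_6_rect_15_5: "spread 6 (rect 15 5)"
  by (rule spread_if_peels[where k = 12 and r = 3 and cs =
     "[(-1,-1,-3,1,0,0), (-2,1,-1,1,0,1), (1,-1,11,0,1,0), (1,-2,8,0,1,0), (2,-1,20,0,1,3),
      (2,1,22,0,1,4), (2,1,19,1,0,9), (2,1,16,1,0,8), (2,-1,10,0,1,0), (1,1,7,0,1,4),
      (1,-1,2,0,1,0), (2,-1,2,1,0,3), (0,0,-1,1,0,2)]"]) code_simp+

lemma spread_6_rect_16_5: "spread 6 (rect 16 5)"
  by (rule spread_if_peels[where k = 13 and r = 2 and cs =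
     "[(-1,1,1,1,0,0), (1,-1,12,0,1,0), (-1,2,2,0,1,4), (-2,1,-4,0,1,1), (2,1,29,0,1,4),
      (-2,1,-7,1,0,3), (-2,-1,-13,0,1,0), (-2,-1,-16,1,0,6), (-2,1,-14,0,1,4), (-1,-1,-11,0,1,0),
      (-1,1,-8,0,1,4), (-2,-1,-25,1,0,11), (-1,2,-10,0,1,3), (0,0,-1,0,1,1)]"]) code_simp+

lemma spread_6_rect_18_5: "spread 6 (rect 18 5)"
  by (rule spread_if_peels[where k = 14 and r = 6 and cs =
     "[(1,1,18,0,1,4), (-1,-1,-3,1,0,0), (-1,-2,-6,0,1,0), (1,2,19,0,1,4), (-2,-1,-8,0,1,3),
      (-2,-1,-11,1,0,3), (2,1,30,0,1,1), (-2,1,-9,0,1,4), (-2,1,-12,1,0,6), (-2,-1,-18,0,1,0),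
      (-1,1,-7,0,1,4), (-1,2,-7,0,1,3), (2,1,27,1,0,14), (2,-1,21,0,1,0), (0,0,-1,0,1,1)]"]) code_simp+

lemma spread_6_rect_6_6: "spread 6 (rect 6 6)"
  by (rule spread_if_peels[where k = 5 and r = 6 and cs =
     "[(-1,-1,-3,1,0,0), (-1,-2,-6,0,1,0), (-2,-1,-7,1,0,0), (1,-2,-2,0,1,2), (-2,1,-3,1,0,2),
      (0,0,-1,1,0,4)]"]) code_simp+

lemma spread_6_rect_7_6: "spread 6 (rect 7 6)"
  by (rule spread_if_peels[where k = 6 and r = 6 and cs =
     "[(1,1,8,0,1,5), (1,-1,3,0,1,0), (1,2,10,0,1,5), (-1,-1,-3,1,0,0), (-1,1,1,1,0,0),
      (-2,-1,-8,1,0,2), (0,0,-1,0,1,2)]"]) code_simp+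

lemma spread_6_rect_9_6: "spread 6 (rect 9 6)"
  by (rule spread_if_peels[where k = 8 and r = 6 and cs =
     "[(-1,1,2,1,0,0), (1,1,10,0,1,5), (-2,1,-1,1,0,0), (2,1,15,1,0,8), (2,-1,9,0,1,0),
      (2,-1,6,1,0,5), (1,-2,-1,0,1,0), (2,1,10,1,0,4), (0,0,-1,1,0,3)]"]) code_simp+

lemma spread_6_rect_7_7: "spread 6 (rect 7 7)"
  by (rule spread_if_peels[where k = 8 and r = 1 and cs =
     "[(1,-1,3,0,1,0), (1,-2,0,0,1,0), (1,1,9,0,1,6), (1,2,12,0,1,6), (1,1,6,0,1,3), (0,1,3,1,0,0),
      (-1,1,0,1,0,0), (-1,-2,-9,0,1,2), (0,0,-1,1,0,3)]"]) code_simp+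

lemma spread_6_rect_8_7: "spread 6 (rect 8 7)"
  by (rule spread_if_peels[where k = 9 and r = 2 and cs =
     "[(1,1,10,0,1,6), (2,1,14,1,0,7), (-1,1,3,1,0,0), (-1,-1,-3,1,0,0), (-1,-2,-6,0,1,0),
      (2,-1,7,1,0,6), (1,-1,0,1,0,4), (-2,-1,-9,1,0,2), (-1,-2,-15,1,0,3), (0,0,-1,0,1,6)]"]) code_simp+

lemma spread_6_rect_10_7: "spread 6 (rect 10 7)"
  by (rule spread_if_peels[where k = 11 and r = 4 and cs =
     "[(-1,-1,-3,1,0,0), (-2,-1,-6,1,0,0), (1,1,12,0,1,6), (-2,1,0,1,0,1), (1,2,15,0,1,6),
      (-1,2,4,1,0,3), (-2,-1,-9,1,0,3), (-2,-1,-12,1,0,4), (-2,1,-10,0,1,4), (-1,-1,-9,0,1,0),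
      (-2,-1,-19,1,0,7), (0,0,-1,0,1,3)]"]) code_simp+

lemma spread_6_rect_10_10: "spread 6 (rect 10 10)"
  by (rule spread_if_peels[where k = 16 and r = 4 and cs =
     "[(-1,-1,-3,1,0,0), (-2,-1,-6,1,0,0), (1,1,15,0,1,9), (-1,1,6,1,0,0), (1,2,21,0,1,9),
      (1,-1,6,0,1,0), (1,-2,3,0,1,0), (-1,-2,-8,0,1,1), (-2,-1,-9,1,0,1), (-1,2,11,0,1,8),
      (-2,1,-2,1,0,3), (-2,-1,-13,1,0,4), (-1,-2,-14,0,1,3), (-1,1,0,1,0,5), (-1,2,3,0,1,6),
      (-1,2,0,0,1,5), (0,0,-1,0,1,3)]"]) code_simp+

text \<open>The exception of five points in bi-degree \<open>(5, 4)\<close>: after four pieces of size six the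
  remaining six points lie on a conic, and one point determines only five of them.\<close>

lemma fills_rect_6_5: "fills (rect 6 5) (\<lambda>s. sum_list (take s [6,6,6,6,5,1]))"
  by (rule fills_if_peels[where cs =
     "[(1,1,6,0,1,4), (1,2,7,0,1,4), (-1,2,1,1,0,0), (1,1,3,0,1,1), (-2,-1,-6,0,1,0),
      (0,0,-1,1,0,3)]"]) code_simp+

section \<open>All rectangles\<close>

lemma spread_0: "spread m (rect 0 B)"
  unfolding spread_def fills_def using determined_empty by (auto simp: rect_def)

lemma spread_add_multiple:
  assumes "spread m (rect A B)" "m dvd A * B" "spread m (rect A' B)"
  shows "spread m (rect (k * A + A') B)"
proof (induction k)
  case (Suc k)
  then show ?case using spread_beside[OF assms(1,2)] by (simp add: add.assoc)
qed (simp add: assms(3))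

text \<open>A \<open>4 \<times> 3\<close> rectangle consists of two triangles with rows of three, two and one points.\<close>

lemma spread_blocks: "spread 6 (rect (4 * i) (3 * j))"
proof -
  have "spread 6 (rect (i * 4 + 0) 3)"
    by (rule spread_add_multiple[OF spread_6_rect_4_3 _ spread_0]) simp
  then have "spread 6 (rect (j * 3 + 0) (4 * i))"
    by (intro spread_add_multiple spread_0) (simp_all add: spread_swap mult.commute)
  then show ?thesis using spread_swap by (simp add: mult.commute)
qed

text \<open>With three rows a rest of two columns is six points on two lines, hence on a conic; every other rest is
  harmless.\<close>

lemma spread_rect_3:
  assumes "A mod 4 \<noteq> 2"
  shows "spread 6 (rect A 3)"
proof -
  have "spread 6 (rect (A mod 4) 3)"
  proof -
    have "A mod 4 < 4" by simp
    then consider "A mod 4 = 0" | "A mod 4 = 1" | "A mod 4 = 3" using assms by linarith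
    then show ?thesis using spread_0 spread_6_rect_1_3 spread_6_rect_3_3 by cases auto
  qed
  then have "spread 6 (rect ((A div 4) * 4 + A mod 4) 3)"
    by (intro spread_add_multiple spread_6_rect_4_3) simp_all
  then show ?thesis by simp
qed

lemma spread_rect_6:
  assumes "A \<ge> 6"
  shows "spread 6 (rect A 6)"
  using assms
proof (induction A rule: less_induct)
  case (less A)
  consider "A = 6" | "A = 7" | "A = 8" | "A = 9" | "A \<ge> 10" using less.prems by linarith
  then show ?case
  proof cases
    case 3
    then show ?thesis using spread_blocks[of 2 2] by simp
  next
    case 5
    then have "spread 6 (rect (4 + (A - 4)) 6)"
      using spread_blocks[of 1 2] less.IH[of "A - 4"] by (intro spread_beside) simp_all
    then show ?thesis using 5 by simp
  qed (use spread_6_rect_6_6 spread_6_rect_7_6 spread_6_rect_9_6 in auto)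
qed

text \<open>Strips with twelve columns reduce the width modulo \<open>12\<close>; the width \<open>18\<close> needs a
  partition of its own because \<open>6\<close> fails.\<close>

lemma spread_rect_5:
  assumes "A \<ge> 5" "A \<noteq> 6"
  shows "spread 6 (rect A 5)"
  using assms
proof (induction A rule: less_induct)
  case (less A)
  consider "A \<in> {5, 7, 8, 9, 10, 11, 12, 13, 14, 15, 16, 18}" | "A \<ge> 17" "A \<noteq> 18"
  proof -
    have "A \<in> {5, 7, 8, 9, 10, 11, 12, 13, 14, 15, 16, 18} \<or> A \<ge> 17 \<and> A \<noteq> 18"
      using less.prems by (simp only: insert_iff empty_iff) presburger
    then show ?thesis using that by blast
  qed
  then show ?case
  proof cases
    case 1
    then show ?thesis
      using spread_6_rect_5_5 spread_6_rect_7_5 spread_6_rect_8_5 spread_6_rect_9_5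
        spread_6_rect_10_5 spread_6_rect_11_5 spread_6_rect_12_5 spread_6_rect_13_5
        spread_6_rect_14_5 spread_6_rect_15_5 spread_6_rect_16_5 spread_6_rect_18_5
      by auto
  next
    case 2
    then have "spread 6 (rect (12 + (A - 12)) 5)"
      using less.IH[of "A - 12"] by (intro spread_beside spread_6_rect_12_5) simp_all
    then show ?thesis using 2 by simp
  qed
qed

lemma spread_rect_small:
  assumes "7 \<le> A" "A \<le> B" "B \<le> 10"
  shows "spread 6 (rect A B)"
proof -
  have 78: "spread 6 (rect 7 8)" using spread_6_rect_8_7 by (rule spread_swap)
  have 79: "spread 6 (rect 7 9)"
    using spread_beside[of 6 4 9 3] spread_blocks[of 1 3] spread_swap[OF spread_rect_3[of 9]] by simp
  have 88: "spread 6 (rect 8 8)"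
    using spread_beside[of 6 3 8 5] spread_swap[OF spread_blocks[of 2 1]] spread_swap[OF spread_rect_5[of 8]]
    by simp
  have 89: "spread 6 (rect 8 9)" using spread_blocks[of 2 3] by simp
  have 810: "spread 6 (rect 10 8)"
    using spread_beside[of 6 3 8 7] spread_swap[OF spread_blocks[of 2 1]] 78 by simp
  have 99: "spread 6 (rect 9 9)"
    using spread_beside[of 6 4 9 5] spread_blocks[of 1 3] spread_swap[OF spread_rect_5[of 9]] by simp
  have 910: "spread 6 (rect 10 9)"
    using spread_beside[of 6 4 9 6] spread_blocks[of 1 3] spread_swap[OF spread_rect_6[of 9]] by simp
  have "A \<in> {7, 8, 9, 10}" "B \<in> {7, 8, 9, 10}" using assms by auto
  then show ?thesis
    using assms(2) spread_6_rect_7_7 78 79 spread_swap[OF spread_6_rect_10_7]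
      88 89 spread_swap[OF 810] 99 spread_swap[OF 910] spread_6_rect_10_10
    by auto
qed

text \<open>Strips of width six fit as soon as the height is at least six, so both sides can be reduced to at most
  ten.\<close>

lemma spread_rect:
  assumes "A \<ge> 5" "B \<ge> 5" "(A, B) \<noteq> (5, 6)" "(A, B) \<noteq> (6, 5)"
  shows "spread 6 (rect A B)"
  using assms
proof (induction "A + B" arbitrary: A B rule: less_induct)
  case less
  show ?case
  proof (cases "A < 7 \<or> B < 7")
    case True
    then consider "A = 5" "B \<noteq> 6" | "B = 5" "A \<noteq> 6" | "A = 6" "B \<ge> 6" | "B = 6" "A \<ge> 6"
    proof -
      have "A = 5 \<and> B \<noteq> 6 \<or> B = 5 \<and> A \<noteq> 6 \<or> A = 6 \<and> B \<ge> 6 \<or> B = 6 \<and> A \<ge> 6"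
        using less.prems True unfolding prod.inject by presburger
      then show ?thesis using that by blast
    qed
    then show ?thesis
    proof cases
      case 1
      show ?thesis unfolding 1 by (rule spread_swap, rule spread_rect_5) (use 1 less.prems in auto)
    next
      case 2
      show ?thesis unfolding 2 by (rule spread_rect_5) (use 2 less.prems in auto)
    next
      case 3
      show ?thesis unfolding 3 by (rule spread_swap, rule spread_rect_6) (use 3 in auto)
    next
      case 4
      show ?thesis unfolding 4 by (rule spread_rect_6) (use 4 in auto)
    qed
  next
    case False
    have strip: "spread 6 (rect A B)" if "A \<ge> 11" "B \<ge> 7" "spread 6 (rect (A - 6) B)" for A B
      using spread_beside[of 6 6 B "A - 6"] that spread_swap[OF spread_rect_6[of B]] by simp
    consider "A \<ge> 11" | "B \<ge> 11" | "A \<le> 10" "B \<le> 10" by linarith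
    then show ?thesis
    proof cases
      case 1
      have "spread 6 (rect (A - 6) B)" by (rule less.hyps) (use 1 False in auto)
      then show ?thesis by (rule strip[rotated 2]) (use 1 False in auto)
    next
      case 2
      have "spread 6 (rect A (B - 6))" by (rule less.hyps) (use 2 False in auto)
      then have "spread 6 (rect (B - 6) A)" by (rule spread_swap)
      then have "spread 6 (rect B A)" by (rule strip[rotated 2]) (use 2 False in auto)
      then show ?thesis by (rule spread_swap)
    next
      case 3
      show ?thesis
      proof (cases "A \<le> B")
        case True
        then show ?thesis using 3 False by (intro spread_rect_small) auto
      next
        case False
        then have "spread 6 (rect B A)" using 3 \<open>\<not> (A < 7 \<or> B < 7)\<close> by (intro spread_rect_small) auto
        then show ?thesis by (rule spread_swap)
      qed
    qed
  qed
qed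

definition general_value :: "nat \<Rightarrow> nat \<Rightarrow> nat \<Rightarrow> nat" where
  "general_value a b s =
    (if b = 1 \<and> real s < 2 / 5 * (real a + 1) then 5 * s
     else if \<exists>k. s = 2 * k + 1 \<and> (a, b) = (4 * k + 1, 2) then (a + 1) * (b + 1) - 1
     else if \<exists>k. s = 2 * k + 1 \<and> (a, b) = (3 * k, 3) then (a + 1) * (b + 1) - 1
     else if \<exists>k. s = 2 * k + 1 \<and> (a, b) = (3 * k + 1, 3) then 6 * s - 1
     else if s = 5 \<and> (a, b) = (5, 4) then 29
     else min ((a + 1) * (b + 1)) (6 * s))"

text \<open>Each exceptional case comes from the rest at the right end of the rectangle. Two rows: five conditions
  per point. Three rows: a rest of two columns holds six points, of which one triple point determines
  five. Four rows: a rest of one column is collinear, of which one point determines three; a rest of two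
  columns lies on two lines, of which one point determines five.\<close>

lemma determined_general_value:
  fixes a b s :: nat
  assumes "a \<ge> b" "b \<ge> 1"
  shows "\<exists>C\<subseteq>rect (a + 1) (b + 1). card C = general_value a b s \<and> determined s C"
proof -
  consider "b = 1" | "b = 2" | "b = 3" | "(a, b) = (5, 4)" | "b \<ge> 4" "(a, b) \<noteq> (5, 4)"
    using assms(2) by linarith
  then show ?thesis
  proof cases
    case 1
    \<comment> \<open>Two rows: two points fill five columns.\<close>
    define r where "r = (a + 1) mod 5"
    have "r < 5" by (simp add: r_def)
    then consider "r = 0" | "r = 1" | "r = 2" | "r = 3" | "r = 4" by linarith
    then have "spread 5 (rect r 2)"
      using spread_0 spread_5_rect_1_2 spread_5_rect_2_2 spread_5_rect_3_2 spread_5_rect_4_2 by cases auto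
    then have "spread 5 (rect ((a + 1) div 5 * 5 + r) 2)"
      by (intro spread_add_multiple spread_5_rect_5_2) simp_all
    moreover have "(a + 1) div 5 * 5 + r = a + 1" by (simp only: r_def div_mult_mod_eq)
    moreover have "b + 1 = 2" using 1 by simp
    ultimately have "spread 5 (rect (a + 1) (b + 1))" by (simp only:)
    moreover have "general_value a b s = min ((a + 1) * (b + 1)) (5 * s)"
      using 1 by (auto simp: general_value_def min_def field_simps)
    ultimately show ?thesis unfolding spread_def fills_def card_rect by simp
  next
    case 2
    show ?thesis
    proof (cases "(a + 1) mod 4 = 2")
      case False
      have "\<not> (\<exists>k. s = 2 * k + 1 \<and> (a, b) = (4 * k + 1, 2))" using False by auto presburger
      then have "general_value a b s = min ((a + 1) * (b + 1)) (6 * s)"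
        using 2 by (auto simp: general_value_def)
      moreover have "b + 1 = 3" using 2 by simp
      ultimately show ?thesis
        using spread_rect_3[OF False] unfolding spread_def fills_def card_rect by metis
    next
      case True
      define k where "k = (a + 1) div 4"
      have a: "a = 4 * k + 1" using True unfolding k_def by presburger
      have "fills (rect (4 * k + 2) 3) (\<lambda>s. if s \<le> 2 * k then 6 * s
          else (4 * k) * 3 + (min (card (rect 2 3)) (5 * (s - 2 * k))))"
        using spread_blocks[of k 1] spread_5_rect_2_3 unfolding spread_def[of 5]
        by (intro fills_beside) simp_all
      from this[unfolded fills_def, rule_format, of s]
      obtain C where C: "C \<subseteq> rect (4 * k + 2) 3" "determined s C"
        "card C = (if s \<le> 2 * k then 6 * s else 12 * k + min 6 (5 * (s - 2 * k)))"
        by (auto simp: card_rect)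
      have ab: "a + 1 = 4 * k + 2" "b + 1 = 3" using 2 a by simp_all
      have "general_value a b s = card C"
      proof (cases "s = 2 * k + 1")
        case True
        then show ?thesis using C(3) 2 a by (auto simp: general_value_def)
      next
        case False
        then have "general_value a b s = min ((a + 1) * (b + 1)) (6 * s)"
          using 2 a by (auto simp: general_value_def)
        then show ?thesis using C(3) 2 a False by (auto simp: min_def)
      qed
      then show ?thesis using C unfolding ab by metis
    qed
  next
    case 3
    define k where "k = (a + 1) div 3"
    have "(a + 1) mod 3 < 3" by simp
    then consider "(a + 1) mod 3 = 0" | "(a + 1) mod 3 = 1" | "(a + 1) mod 3 = 2" by linarith
    then show ?thesis
    proof cases
      case *: 1
      have "\<not> (\<exists>k. s = 2 * k + 1 \<and> (a, b) = (3 * k, 3))"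
        "\<not> (\<exists>k. s = 2 * k + 1 \<and> (a, b) = (3 * k + 1, 3))" using * by (auto, presburger+)
      then have "general_value a b s = min ((a + 1) * (b + 1)) (6 * s)"
        using 3 by (auto simp: general_value_def)
      moreover have "a + 1 = 3 * k" using * unfolding k_def by presburger
      then have "spread 6 (rect (a + 1) (b + 1))"
        using spread_swap[OF spread_blocks[of 1 k]] 3 by simp
      ultimately show ?thesis unfolding spread_def fills_def card_rect by metis
    next
      case *: 2
      have a: "a = 3 * k" using * unfolding k_def by presburger
      have "fills (rect (3 * k + 1) 4) (\<lambda>s. if s \<le> 2 * k then 6 * s
          else (3 * k) * 4 + (min (card (rect 1 4)) (3 * (s - 2 * k))))"
        using spread_swap[OF spread_blocks[of 1 k]] spread_3_rect_1_4 unfolding spread_def[of 3]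
        by (intro fills_beside) simp_all
      from this[unfolded fills_def, rule_format, of s]
      obtain C where C: "C \<subseteq> rect (3 * k + 1) 4" "determined s C"
        "card C = (if s \<le> 2 * k then 6 * s else 12 * k + min 4 (3 * (s - 2 * k)))"
        by (auto simp: card_rect)
      have ab: "a + 1 = 3 * k + 1" "b + 1 = 4" using 3 a by simp_all
      have "general_value a b s = card C"
      proof (cases "s = 2 * k + 1")
        case True
        then show ?thesis using C(3) 3 a by (auto simp: general_value_def)
      next
        case False
        have "3 * k \<noteq> 3 * k' + 1" for k' by presburger
        then have "general_value a b s = min ((a + 1) * (b + 1)) (6 * s)"
          using 3 a False by (auto simp: general_value_def)
        then show ?thesis using C(3) 3 a False by (auto simp: min_def)
      qed
      then show ?thesis using C unfolding ab by metis
    next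
      case *: 3
      have a: "a = 3 * k + 1" using * unfolding k_def by presburger
      have "fills (rect (3 * k + 2) 4) (\<lambda>s. if s \<le> 2 * k then 6 * s
          else (3 * k) * 4 + (min (card (rect 2 4)) (5 * (s - 2 * k))))"
        using spread_swap[OF spread_blocks[of 1 k]] spread_5_rect_2_4 unfolding spread_def[of 5]
        by (intro fills_beside) simp_all
      from this[unfolded fills_def, rule_format, of s]
      obtain C where C: "C \<subseteq> rect (3 * k + 2) 4" "determined s C"
        "card C = (if s \<le> 2 * k then 6 * s else 12 * k + min 8 (5 * (s - 2 * k)))"
        by (auto simp: card_rect)
      have ab: "a + 1 = 3 * k + 2" "b + 1 = 4" using 3 a by simp_all
      have ne: "3 * k + 1 \<noteq> 3 * k'" "Suc (3 * k) \<noteq> 3 * k'" for k' by presburger+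
      have "general_value a b s = card C"
      proof (cases "s = 2 * k + 1")
        case True
        then show ?thesis using C(3) 3 a ne by (auto simp: general_value_def)
      next
        case False
        then have "general_value a b s = min ((a + 1) * (b + 1)) (6 * s)"
          using 3 a ne by (auto simp: general_value_def)
        then show ?thesis using C(3) 3 a False by (auto simp: min_def)
      qed
      then show ?thesis using C unfolding ab by metis
    qed
  next
    case 4
    then have "general_value a b s = (if s = 5 then 29 else min 30 (6 * s))"
      by (auto simp: general_value_def)
    also have "\<dots> = sum_list (take s [6, 6, 6, 6, 5, 1])"
    proof -
      consider "s = 0" | "s = 1" | "s = 2" | "s = 3" | "s = 4" | "s = 5" | "s \<ge> 6" by linarith
      then show ?thesis by cases (auto simp: eval_nat_numeral)
    qed
    finally show ?thesis using fills_rect_6_5 4 unfolding fills_def by simp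
  next
    case 5
    then have "general_value a b s = min ((a + 1) * (b + 1)) (6 * s)"
      by (auto simp: general_value_def)
    then show ?thesis
      using spread_rect[of "a + 1" "b + 1"] 5 assms(1) unfolding spread_def fills_def card_rect by auto
  qed
qed

section \<open>Evaluation and Euler operators\<close>

abbreviation expo :: "('v \<Rightarrow>\<^sub>0 nat) \<Rightarrow> 'v \<Rightarrow> nat" where "expo \<equiv> Poly_Mapping.lookup"
abbreviation coeff_of :: "'v cpoly \<Rightarrow> ('v \<Rightarrow>\<^sub>0 nat) \<Rightarrow> complex" where "coeff_of \<equiv> Poly_Mapping.lookup"
abbreviation mterm :: "('v \<Rightarrow>\<^sub>0 nat) \<Rightarrow> complex \<Rightarrow> 'v cpoly" where "mterm \<equiv> Poly_Mapping.single"

definition monom_val :: "('v \<Rightarrow> complex) \<Rightarrow> ('v \<Rightarrow>\<^sub>0 nat) \<Rightarrow> complex" where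
  "monom_val c m = (\<Prod>v\<in>Poly_Mapping.keys m. c v ^ expo m v)"

lemma monom_val_superset:
  assumes "finite S" "Poly_Mapping.keys m \<subseteq> S"
  shows "monom_val c m = (\<Prod>v\<in>S. c v ^ expo m v)"
  unfolding monom_val_def using assms by (intro prod.mono_neutral_left) (auto simp: in_keys_iff)

lemma monom_val_add: "monom_val c (m + n) = monom_val c m * monom_val c n"
proof -
  let ?S = "Poly_Mapping.keys m \<union> Poly_Mapping.keys n"
  have "monom_val c (m + n) = (\<Prod>v\<in>?S. c v ^ expo (m + n) v)"
    by (intro monom_val_superset) (auto simp: keys_add)
  then show ?thesis
    by (simp add: monom_val_superset[of ?S m] monom_val_superset[of ?S n] lookup_add power_add prod.distrib)
qed

lemma monom_val_zero [simp]: "monom_val c 0 = 1"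
  by (simp add: monom_val_def)

lemma cpoly_eval_superset:
  assumes "finite S" "Poly_Mapping.keys F \<subseteq> S"
  shows "cpoly_eval c F = (\<Sum>m\<in>S. coeff_of F m * monom_val c m)"
  unfolding cpoly_eval_def monom_val_def[symmetric] using assms
  by (intro sum.mono_neutral_left) (auto simp: in_keys_iff)

lemma cpoly_eval_add: "cpoly_eval c (F + G) = cpoly_eval c F + cpoly_eval c G"
proof -
  let ?S = "Poly_Mapping.keys F \<union> Poly_Mapping.keys G"
  have "cpoly_eval c (F + G) = (\<Sum>m\<in>?S. coeff_of (F + G) m * monom_val c m)"
    by (intro cpoly_eval_superset) (auto simp: keys_add)
  then show ?thesis
    by (simp add: cpoly_eval_superset[of ?S F] cpoly_eval_superset[of ?S G] lookup_add
        distrib_right sum.distrib)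
qed

lemma cpoly_eval_zero [simp]: "cpoly_eval c 0 = 0"
  by (simp add: cpoly_eval_def)

lemma cpoly_eval_term: "cpoly_eval c (mterm m x) = x * monom_val c m"
  by (simp add: cpoly_eval_superset[of "{m}"])

lemma cpoly_as_sum: "(F :: 'v cpoly) = (\<Sum>m\<in>Poly_Mapping.keys F. mterm m (coeff_of F m))"
  by (rule poly_mapping_eqI) (auto simp: lookup_sum lookup_single when_def in_keys_iff)

text \<open>Bilinear identities need only be checked on terms.\<close>

lemma cpoly_induct [case_names single add]:
  fixes F :: "'v cpoly"
  assumes "\<And>m x. P (mterm m x)" "\<And>F G. P F \<Longrightarrow> P G \<Longrightarrow> P (F + G)"
  shows "P F"
proof -
  have "P (\<Sum>m\<in>S. mterm m (f m))" if "finite S" for S and f :: "_ \<Rightarrow> complex"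
    using that
  proof (induction S)
    case empty
    then show ?case using assms(1)[of 0 0] by simp
  qed (use assms in simp)
  then show ?thesis by (subst cpoly_as_sum) simp
qed

lemma cpoly_eval_mult: "cpoly_eval c (F * G) = cpoly_eval c F * cpoly_eval c G"
proof (induction F rule: cpoly_induct)
  case (single m x)
  show ?case
    by (induction G rule: cpoly_induct)
      (simp_all add: mult_single cpoly_eval_term monom_val_add cpoly_eval_add distrib_left)
qed (simp add: cpoly_eval_add distrib_right)

lemma cpoly_eval_one [simp]: "cpoly_eval c 1 = 1"
  by (simp add: single_one[symmetric] cpoly_eval_term del: single_one)

lemma cpoly_scale_eq_mult: "cpoly_scale x F = mterm 0 x * F"
proof (induction F rule: cpoly_induct)
  case (single m y)
  show ?case
    unfolding mult_single by (rule poly_mapping_eqI) (simp add: lookup_single when_def)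
next
  case (add F G)
  then show ?case by (simp add: cpoly.scale_right_distrib distrib_left)
qed

text \<open>The Euler operator \<open>v \<partial>/\<partial>v\<close>, a derivation that is diagonal on monomials.\<close>

definition euler :: "'v \<Rightarrow> 'v cpoly \<Rightarrow> 'v cpoly" where
  "euler v F = Poly_Mapping.mapp (\<lambda>m x. of_nat (expo m v) * x) F"

lemma lookup_euler: "coeff_of (euler v F) m = of_nat (expo m v) * coeff_of F m"
  by (simp add: euler_def mapp.rep_eq when_def in_keys_iff)

lemma euler_add: "euler v (F + G) = euler v F + euler v G"
  by (rule poly_mapping_eqI) (simp add: lookup_euler lookup_add distrib_left)

lemma euler_zero: "euler v 0 = 0"
  by (rule poly_mapping_eqI) (simp add: lookup_euler)

lemma euler_term: "euler v (mterm m x) = mterm m (of_nat (expo m v) * x)"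
  by (rule poly_mapping_eqI) (simp add: lookup_euler lookup_single when_def)

lemma euler_mult: "euler v (F * G) = euler v F * G + F * euler v G"
proof (induction F rule: cpoly_induct)
  case (single m x)
  show ?case
  proof (induction G rule: cpoly_induct)
    case (single n y)
    show ?case
      unfolding mult_single euler_term single_add[symmetric]
      by (rule arg_cong[of _ _ "mterm (m + n)"]) (simp only: lookup_add of_nat_add distrib_left distrib_right mult.assoc mult.left_commute)
  next
    case (add F G)
    show ?case unfolding distrib_left euler_add add.IH by (simp only: add.assoc add.left_commute)
  qed
next
  case (add F G)
  show ?case unfolding distrib_right euler_add add.IH by (simp only: add.assoc add.left_commute)
qed

lemma ideal_span_zero_on:
  assumes "\<And>f. f \<in> B \<Longrightarrow> cpoly_eval c f = 0" "f \<in> ideal.span B"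
  shows "cpoly_eval c f = 0"
  using assms(2)
proof (induction rule: ideal.span_induct_alt)
  case (step x y z)
  then show ?case by (simp add: cpoly_eval_add cpoly_eval_mult assms(1))
qed simp

lemma point_ideal_eval:
  assumes "f \<in> point_ideal P" "c \<in> point_coords P"
  shows "cpoly_eval c f = 0"
  by (rule ideal_span_zero_on[OF _ assms(1)[unfolded point_ideal_def]]) (use assms(2) in auto)

lemma ideal_power_mult: "f \<in> ideal_power I n \<Longrightarrow> r * f \<in> ideal_power I n"
  by (cases n) (simp_all add: ideal.span_scale)

lemma ideal_power_add: "f \<in> ideal_power I n \<Longrightarrow> g \<in> ideal_power I n \<Longrightarrow> f + g \<in> ideal_power I n"
  by (cases n) (simp_all add: ideal.span_add)

lemma ideal_power_zero: "0 \<in> ideal_power I n"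
  by (cases n) (simp_all add: ideal.span_zero)

lemma ideal_power_SucI: "f \<in> I \<Longrightarrow> g \<in> ideal_power I n \<Longrightarrow> f * g \<in> ideal_power I (Suc n)"
  unfolding ideal_power.simps by (rule ideal.span_base) blast

text \<open>A derivation lowers the order of vanishing by at most one.\<close>

lemma euler_ideal_power: "f \<in> ideal_power I (Suc n) \<Longrightarrow> euler v f \<in> ideal_power I n"
proof (induction n arbitrary: f)
  case (Suc n)
  from Suc.prems have "f \<in> ideal.span {f * g | f g. f \<in> I \<and> g \<in> ideal_power I (Suc n)}" by simp
  then show ?case
  proof (induction rule: ideal.span_induct_alt)
    case base
    then show ?case by (simp only: euler_zero ideal_power_zero)
  next
    case (step r y z)
    then obtain f g where y: "y = f * g" "f \<in> I" "g \<in> ideal_power I (Suc n)" by blast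
    have eq: "euler v (r * y + z) =
        (euler v r * f + r * euler v f) * g + r * (f * euler v g) + euler v z"
      by (simp only: y(1) euler_add euler_mult distrib_left distrib_right mult.assoc add.assoc)
    have "f * euler v g \<in> ideal_power I (Suc n)" by (rule ideal_power_SucI[OF y(2) Suc.IH[OF y(3)]])
    from ideal_power_add[OF ideal_power_add[OF ideal_power_mult[OF y(3)] ideal_power_mult[OF this]] step.IH]
    show ?case unfolding eq .
  qed
qed simp

lemma ideal_power_Suc_eval:
  assumes "f \<in> ideal_power (point_ideal P) (Suc n)" "c \<in> point_coords P"
  shows "cpoly_eval c f = 0"
  by (rule ideal_span_zero_on[OF _ assms(1)[unfolded ideal_power.simps]])
    (auto simp: cpoly_eval_mult point_ideal_eval[OF _ assms(2)])

section \<open>Codimension of subspaces of the space of polynomials\<close>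

text \<open>Codimension of \<open>W\<close> relative to \<open>V\<close>, in a form that can be iterated: it bounds
  the drop in dimension for every subspace of \<open>V\<close>, so it is subadditive under intersection.\<close>

definition codim_le :: "'v cpoly set \<Rightarrow> 'v cpoly set \<Rightarrow> nat \<Rightarrow> bool" where
  "codim_le V W k \<longleftrightarrow> cpoly.subspace W \<and>
     (\<forall>A. cpoly.subspace A \<longrightarrow> A \<subseteq> V \<longrightarrow> cpoly.dim A \<le> cpoly.dim (A \<inter> W) + k)"

lemma codim_le_Int:
  assumes "codim_le V W k" "codim_le V W' k'"
  shows "codim_le V (W \<inter> W') (k + k')"
  unfolding codim_le_def
proof (intro conjI allI impI)
  show "cpoly.subspace (W \<inter> W')"
    using assms unfolding codim_le_def by (auto intro: cpoly.subspace_inter)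
  fix A assume A: "cpoly.subspace A" "A \<subseteq> V"
  have "cpoly.dim A \<le> cpoly.dim (A \<inter> W) + k" using assms(1) A unfolding codim_le_def by blast
  also have "cpoly.subspace (A \<inter> W)" "A \<inter> W \<subseteq> V"
    using assms(1) A unfolding codim_le_def by (auto intro: cpoly.subspace_inter)
  then have "cpoly.dim (A \<inter> W) \<le> cpoly.dim (A \<inter> W \<inter> W') + k'"
    using assms(2) unfolding codim_le_def by blast
  finally show "cpoly.dim A \<le> cpoly.dim (A \<inter> (W \<inter> W')) + (k + k')" by (simp add: Int_assoc)
qed

lemma codim_le_UNIV: "codim_le V UNIV 0"
  by (simp add: codim_le_def cpoly.subspace_UNIV)

lemma codim_le_INT:
  assumes "finite K" "\<And>i. i \<in> K \<Longrightarrow> codim_le V (W i) k"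
  shows "codim_le V (\<Inter>i\<in>K. W i) (card K * k)"
  using assms
proof (induction K)
  case (insert i K)
  then have "codim_le V (W i \<inter> (\<Inter>i\<in>K. W i)) (k + card K * k)" by (intro codim_le_Int) auto
  then show ?case using insert.hyps by simp
qed (simp add: codim_le_UNIV)

text \<open>If any two elements of \<open>V\<close> are dependent modulo \<open>W\<close>, then a basis of \<open>A
  \<inter> W\<close> and one further element span \<open>A\<close>.\<close>

lemma codim_le_one:
  assumes V: "V \<subseteq> cpoly.span B" "finite B" and W: "cpoly.subspace W"
    and line: "\<And>f g. f \<in> V \<Longrightarrow> g \<in> V \<Longrightarrow> g \<notin> W \<Longrightarrow> \<exists>x. f - cpoly_scale x g \<in> W"
  shows "codim_le V W 1"
  unfolding codim_le_def
proof (intro conjI allI impI W)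
  fix A assume A: "cpoly.subspace A" "A \<subseteq> V"
  obtain B' where B': "B' \<subseteq> A \<inter> W" "cpoly.independent B'" "A \<inter> W \<subseteq> cpoly.span B'"
    "card B' = cpoly.dim (A \<inter> W)"
    using cpoly.basis_exists[of "A \<inter> W"] by blast
  have fin: "finite B'"
    using cpoly.independent_span_bound[OF V(2) B'(2)] B'(1) A(2) V(1) by blast
  show "cpoly.dim A \<le> cpoly.dim (A \<inter> W) + 1"
  proof (cases "A \<subseteq> W")
    case True
    then show ?thesis by (simp add: Int_absorb2)
  next
    case False
    then obtain g where g: "g \<in> A" "g \<notin> W" by blast
    have "A \<subseteq> cpoly.span (insert g B')"
    proof
      fix f assume "f \<in> A"
      then obtain x where x: "f - cpoly_scale x g \<in> W" using line g A(2) by blast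
      have "f - cpoly_scale x g \<in> A"
        using A(1) \<open>f \<in> A\<close> g(1) by (intro cpoly.subspace_diff cpoly.subspace_scale)
      then have "f - cpoly_scale x g \<in> cpoly.span B'" using x B'(3) by blast
      then show "f \<in> cpoly.span (insert g B')" unfolding cpoly.span_insert by blast
    qed
    then have "cpoly.dim A \<le> card (insert g B')" using fin by (intro cpoly.dim_le_card) auto
    also have "\<dots> \<le> card B' + 1" using fin by (simp add: card_insert_if)
    finally show ?thesis using B'(4) by simp
  qed
qed

definition linear_form :: "('v cpoly \<Rightarrow> complex) \<Rightarrow> bool" where
  "linear_form \<phi> \<longleftrightarrow> (\<forall>f g. \<phi> (f + g) = \<phi> f + \<phi> g) \<and> (\<forall>x f. \<phi> (cpoly_scale x f) = x * \<phi> f)"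

lemma codim_le_kernel:
  assumes V: "V \<subseteq> cpoly.span B" "finite B" and \<phi>: "linear_form \<phi>"
  shows "codim_le V {f. \<phi> f = 0} 1"
proof (rule codim_le_one[OF V])
  have add: "\<phi> (f + g) = \<phi> f + \<phi> g" and scale: "\<phi> (cpoly_scale x f) = x * \<phi> f" for f g x
    using \<phi> unfolding linear_form_def by blast+
  have zero: "\<phi> 0 = 0" using add[of 0 0] by simp
  show "cpoly.subspace {f. \<phi> f = 0}"
    unfolding cpoly.subspace_def by (simp add: zero add scale)
  have diff: "\<phi> (f - g) = \<phi> f - \<phi> g" for f g using add[of "f - g" g] by simp
  fix f g assume "g \<notin> {f. \<phi> f = 0}"
  then have "\<phi> (f - cpoly_scale (\<phi> f / \<phi> g) g) = 0" by (simp add: diff scale)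
  then show "\<exists>x. f - cpoly_scale x g \<in> {f. \<phi> f = 0}" by blast
qed

lemma codim_le_span:
  assumes V: "V \<subseteq> cpoly.span B" "finite B" and W: "cpoly.subspace W" and "finite T"
    and "V \<subseteq> cpoly.span (T \<union> W)"
  shows "codim_le V W (card T)"
  using \<open>finite T\<close> W assms(5)
proof (induction T arbitrary: W)
  case empty
  then have "V \<subseteq> W" by (simp add: cpoly.span_eq_iff[THEN iffD2])
  then have "A \<inter> W = A" if "A \<subseteq> V" for A using that by blast
  then show ?case using empty by (auto simp: codim_le_def)
next
  case (insert t T)
  define U where "U = cpoly.span (insert t W)"
  have U: "f \<in> U \<longleftrightarrow> (\<exists>x. f - cpoly_scale x t \<in> W)" for f
    unfolding U_def cpoly.span_insert using insert.prems(1) by (simp add: cpoly.span_eq_iff[THEN iffD2])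
  have sub: "cpoly.subspace U" unfolding U_def by (rule cpoly.subspace_span)
  have "insert t T \<union> W \<subseteq> T \<union> U"
    unfolding U_def using cpoly.span_superset[of "insert t W"] by blast
  then have "V \<subseteq> cpoly.span (T \<union> U)"
    using insert.prems(2) cpoly.span_mono by blast
  then have 1: "codim_le V U (card T)" by (rule insert.IH[OF sub])
  have 2: "codim_le (V \<inter> U) W 1"
  proof (rule codim_le_one[OF _ assms(2) insert.prems(1)])
    show "V \<inter> U \<subseteq> cpoly.span B" using assms(1) by blast
    fix f g assume fg: "f \<in> V \<inter> U" "g \<in> V \<inter> U" "g \<notin> W"
    obtain x y where xy: "f - cpoly_scale x t \<in> W" "g - cpoly_scale y t \<in> W" using fg U by blast
    have y: "y \<noteq> 0" using xy(2) fg(3) by auto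
    have "(f - cpoly_scale x t) - cpoly_scale (x / y) (g - cpoly_scale y t) \<in> W"
      by (rule cpoly.subspace_diff[OF insert.prems(1) xy(1)
            cpoly.subspace_scale[OF insert.prems(1) xy(2)]])
    also have "(f - cpoly_scale x t) - cpoly_scale (x / y) (g - cpoly_scale y t) = f - cpoly_scale (x / y) g"
      using y by (simp add: cpoly.scale_right_diff_distrib)
    finally show "\<exists>x. f - cpoly_scale x g \<in> W" by blast
  qed
  show ?case
    unfolding codim_le_def
  proof (intro conjI allI impI insert.prems(1))
    fix A assume A: "cpoly.subspace A" "A \<subseteq> V"
    have "U \<inter> W = W" unfolding U_def using cpoly.span_superset[of "insert t W"] by blast
    have "cpoly.dim A \<le> cpoly.dim (A \<inter> U) + card T" using 1 A unfolding codim_le_def by blast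
    also have "cpoly.dim (A \<inter> U) \<le> cpoly.dim (A \<inter> U \<inter> W) + 1"
      using 2 A sub cpoly.subspace_inter[of A U] unfolding codim_le_def by blast
    also have "A \<inter> U \<inter> W = A \<inter> W" using \<open>U \<inter> W = W\<close> by blast
    finally show "cpoly.dim A \<le> cpoly.dim (A \<inter> W) + card (insert t T)" using insert.hyps by simp
  qed
qed

section \<open>A triple point imposes at most six conditions\<close>

lemma p1_coords_abs: "u \<noteq> (0, 0) \<Longrightarrow> p1_coords (abs_p1 u) = {v. proportional u v}"
  by (rule p1_coords.abs_eq) (simp add: proportional_def exI[of _ 1])

lemma p1_coords_cases:
  obtains u where "u \<noteq> (0, 0)" "p1_coords p = {v. proportional u v}"
proof (induction p rule: p1.abs_induct)
  case (1 u)
  then have "u \<noteq> (0, 0)" by (simp add: proportional_def)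
  then show ?case using 1(2) p1_coords_abs by blast
qed

lemma point_coords_nonempty: "\<exists>c. c \<in> point_coords P"
proof -
  obtain u v where u: "u \<noteq> (0, 0)" "p1_coords (fst P) = {w. proportional u w}"
    and v: "v \<noteq> (0, 0)" "p1_coords (snd P) = {w. proportional v w}"
    using p1_coords_cases by metis
  have "proportional w w" if "w \<noteq> (0, 0)" for w using that by (simp add: proportional_def exI[of _ 1])
  then show ?thesis
    using u v unfolding point_coords_def
    by (intro exI[of _ "case_coord (fst u) (snd u) (fst v) (snd v)"]) simp
qed

lemma point_coords_nonzero:
  assumes "c \<in> point_coords P"
  shows "(c X0, c X1) \<noteq> (0, 0)" "(c Y0, c Y1) \<noteq> (0, 0)"
proof -
  obtain u where "p1_coords (fst P) = {w. proportional u w}" using p1_coords_cases by metis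
  then show "(c X0, c X1) \<noteq> (0, 0)" using assms by (simp add: point_coords_def proportional_def)
  obtain v where "p1_coords (snd P) = {w. proportional v w}" using p1_coords_cases by metis
  then show "(c Y0, c Y1) \<noteq> (0, 0)" using assms by (simp add: point_coords_def proportional_def)
qed

lemma p1_coords_scale:
  assumes "(s, t) \<in> p1_coords p" "(s', t') \<in> p1_coords p"
  shows "\<exists>x. s' = x * s \<and> t' = x * t"
proof -
  obtain u where "p1_coords p = {w. proportional u w}" using p1_coords_cases by metis
  then obtain x y where "x \<noteq> 0" "(s, t) = (x * fst u, x * snd u)" "(s', t') = (y * fst u, y * snd u)"
    using assms unfolding proportional_def by auto
  then show ?thesis by (intro exI[of _ "y / x"]) simp
qed

lemma UNIV_coord: "(UNIV :: coord set) = {X0, X1, Y0, Y1}"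
  using coord.exhaust by blast

lemma prod_UNIV_coord: "(\<Prod>v\<in>UNIV. f v) = f X0 * f X1 * f Y0 * (f Y1 :: 'a :: comm_monoid_mult)"
  unfolding UNIV_coord by (simp add: mult.assoc)

lemma monom_val_coord:
  "monom_val c m = c X0 ^ expo m X0 * c X1 ^ expo m X1 * c Y0 ^ expo m Y0 * c Y1 ^ expo m Y1"
proof -
  have "finite (UNIV :: coord set)" unfolding UNIV_coord by simp
  then have "monom_val c m = (\<Prod>v\<in>UNIV. c v ^ expo m v)" by (rule monom_val_superset) simp
  also have "\<dots> = c X0 ^ expo m X0 * c X1 ^ expo m X1 * c Y0 ^ expo m Y0 * c Y1 ^ expo m Y1"
    by (rule prod_UNIV_coord)
  finally show ?thesis .
qed

text \<open>Two coordinate vectors of a point differ by a scalar in each factor, which multiplies the value of a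
  bi-homogeneous form by a power product. So one coordinate vector decides membership.\<close>

lemma point_ideal_memI:
  assumes "F \<in> bihomogeneous i j" "c \<in> point_coords P" "cpoly_eval c F = 0"
  shows "F \<in> point_ideal P"
proof -
  have "cpoly_eval c' F = 0" if c': "c' \<in> point_coords P" for c'
  proof -
    have "\<exists>x. c' X0 = x * c X0 \<and> c' X1 = x * c X1" "\<exists>y. c' Y0 = y * c Y0 \<and> c' Y1 = y * c Y1"
      using assms(2) c' unfolding point_coords_def by (auto intro: p1_coords_scale)
    then obtain x y where xy: "c' X0 = x * c X0" "c' X1 = x * c X1" "c' Y0 = y * c Y0" "c' Y1 = y * c Y1"
      by blast
    have "coeff_of F m * monom_val c' m = x ^ i * y ^ j * (coeff_of F m * monom_val c m)"
      if "m \<in> Poly_Mapping.keys F" for m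
    proof -
      have deg: "expo m X0 + expo m X1 = i" "expo m Y0 + expo m Y1 = j"
        using that assms(1) unfolding bihomogeneous_def bidegree_def by auto
      show ?thesis
        unfolding monom_val_coord xy power_mult_distrib deg[symmetric] power_add
        by (simp only: mult_ac)
    qed
    then have "cpoly_eval c' F = x ^ i * y ^ j * cpoly_eval c F"
      unfolding cpoly_eval_superset[OF finite_keys order_refl] sum_distrib_left
      by (rule sum.cong[OF refl])
    then show ?thesis using assms(3) by simp
  qed
  then show ?thesis
    unfolding point_ideal_def using assms(1) by (intro ideal.span_base) blast
qed

lemma cpoly_scale_mult_left: "cpoly_scale x F * G = cpoly_scale x (F * G)"
  by (simp only: cpoly_scale_eq_mult mult.assoc)

lemma cpoly_scale_mult_right: "F * cpoly_scale x G = cpoly_scale x (F * G)"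
  by (simp only: cpoly_scale_eq_mult mult.left_commute)

lemma cpoly_span_mult:
  assumes "F \<in> cpoly.span S" "G \<in> cpoly.span T"
  shows "F * G \<in> cpoly.span {f * g | f g. f \<in> S \<and> g \<in> T}" (is "_ \<in> cpoly.span ?R")
  using assms(1)
proof (induction rule: cpoly.span_induct_alt)
  case base
  show ?case by (simp add: cpoly.span_zero)
next
  case (step x f F)
  have "f * G \<in> cpoly.span ?R"
    using assms(2)
  proof (induction rule: cpoly.span_induct_alt)
    case base
    show ?case by (simp add: cpoly.span_zero)
  next
    case (step y g G)
    have "f * g \<in> ?R" using step.hyps \<open>f \<in> S\<close> by blast
    then have "cpoly_scale y (f * g) + f * G \<in> cpoly.span ?R"
      by (intro cpoly.span_add cpoly.span_scale cpoly.span_base step.IH)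
    then show ?case by (simp only: distrib_left cpoly_scale_mult_right)
  qed
  then have "cpoly_scale x (f * G) + F * G \<in> cpoly.span ?R"
    by (intro cpoly.span_add cpoly.span_scale step.IH)
  then show ?case by (simp only: distrib_right cpoly_scale_mult_left)
qed

text \<open>A binary form can be rewritten in terms of any linear forms that span the two variables.\<close>

lemma binary_forms_span:
  assumes "x \<in> cpoly.span {X, l}" "y \<in> cpoly.span {X, l}"
  shows "x ^ w * y ^ u \<in> cpoly.span ((\<lambda>i. l ^ i * X ^ (w + u - i)) ` {..w + u})"
proof -
  let ?E = "\<lambda>n. cpoly.span ((\<lambda>i. l ^ i * X ^ (n - i)) ` {..n})"
  have step: "h * F \<in> ?E (Suc n)" if h: "h \<in> cpoly.span {X, l}" and F: "F \<in> ?E n" for h F n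
  proof -
    have "{f * g | f g. f \<in> {X, l} \<and> g \<in> (\<lambda>i. l ^ i * X ^ (n - i)) ` {..n}}
        \<subseteq> (\<lambda>i. l ^ i * X ^ (Suc n - i)) ` {..Suc n}"
    proof
      fix f assume "f \<in> {f * g | f g. f \<in> {X, l} \<and> g \<in> (\<lambda>i. l ^ i * X ^ (n - i)) ` {..n}}"
      then obtain i where i: "i \<le> n" "f = X * (l ^ i * X ^ (n - i)) \<or> f = l * (l ^ i * X ^ (n - i))"
        by blast
      have "X * (l ^ i * X ^ (n - i)) = l ^ i * X ^ (Suc n - i)"
        unfolding Suc_diff_le[OF i(1)] power_Suc by (rule mult.left_commute)
      moreover have "l * (l ^ i * X ^ (n - i)) = l ^ Suc i * X ^ (Suc n - Suc i)"
        by (simp only: power_Suc mult.assoc diff_Suc_Suc)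
      ultimately have "f = l ^ i * X ^ (Suc n - i) \<or> f = l ^ Suc i * X ^ (Suc n - Suc i)"
        using i(2) by (simp only:)
      moreover have "i \<in> {..Suc n}" "Suc i \<in> {..Suc n}" using i(1) by auto
      ultimately show "f \<in> (\<lambda>i. l ^ i * X ^ (Suc n - i)) ` {..Suc n}" by blast
    qed
    then show ?thesis using cpoly_span_mult[OF h F] cpoly.span_mono by blast
  qed
  have y: "y ^ u \<in> ?E u"
  proof (induction u)
    case 0
    then show ?case by (simp add: cpoly.span_base)
  next
    case (Suc u)
    show ?case unfolding power_Suc by (rule step[OF assms(2) Suc])
  qed
  show ?thesis
  proof (induction w)
    case 0
    then show ?case using y by simp
  next
    case (Suc w)
    show ?case unfolding power_Suc mult.assoc add_Suc by (rule step[OF assms(1) Suc])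
  qed
qed

text \<open>The form \<open>l\<close> that vanishes at the point \<open>(p : q)\<close> is complemented by one of the
  two variables.\<close>

lemma linear_forms_span:
  fixes x y :: "'v cpoly" and p q :: complex
  assumes "(p, q) \<noteq> (0, 0)"
  defines "l \<equiv> cpoly_scale q x - cpoly_scale p y"
  shows "\<exists>X. x \<in> cpoly.span {X, l} \<and> y \<in> cpoly.span {X, l}"
proof (cases "p = 0")
  case False
  have "y = cpoly_scale (q / p) x + cpoly_scale (- 1 / p) l"
    using False by (simp add: l_def cpoly.scale_right_diff_distrib cpoly.scale_minus_left)
  also have "\<dots> \<in> cpoly.span {x, l}"
    by (intro cpoly.span_add cpoly.span_scale cpoly.span_base) auto
  finally show ?thesis using cpoly.span_base[of x "{x, l}"] by blast
next
  case True
  then have q: "q \<noteq> 0" using assms(1) by simp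
  have "x = cpoly_scale (p / q) y + cpoly_scale (1 / q) l"
    using q by (simp add: l_def cpoly.scale_right_diff_distrib)
  also have "\<dots> \<in> cpoly.span {y, l}"
    by (intro cpoly.span_add cpoly.span_scale cpoly.span_base) auto
  finally show ?thesis using cpoly.span_base[of y "{y, l}"] by blast
qed

lemma ideal_power_products:
  assumes "f \<in> I" "g \<in> I" "n \<le> i + j"
  shows "f ^ i * (g ^ j * h) \<in> ideal_power I n"
  using assms(3)
proof (induction n arbitrary: i j)
  case (Suc n)
  show ?case
  proof (cases i)
    case 0
    then obtain k where k: "j = Suc k" using Suc.prems by (cases j) auto
    have "f ^ 0 * (g ^ k * h) \<in> ideal_power I n" using Suc.prems 0 k by (intro Suc.IH) simp
    then have "g * (f ^ 0 * (g ^ k * h)) \<in> ideal_power I (Suc n)" by (rule ideal_power_SucI[OF assms(2)])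
    then show ?thesis unfolding 0 k power_Suc by (simp only: power_0 mult_1_left mult.assoc)
  next
    case (Suc k)
    have "f ^ k * (g ^ j * h) \<in> ideal_power I n" using Suc.prems Suc by (intro Suc.IH) simp
    then have "f * (f ^ k * (g ^ j * h)) \<in> ideal_power I (Suc n)" by (rule ideal_power_SucI[OF assms(1)])
    then show ?thesis unfolding Suc power_Suc by (simp only: mult.assoc)
  qed
qed simp

lemma ideal_power_subspace: "cpoly.subspace (ideal_power (I :: 'v cpoly set) n)"
  unfolding cpoly.subspace_def cpoly_scale_eq_mult
  using ideal_power_zero ideal_power_add ideal_power_mult by blast

definition var :: "'v \<Rightarrow> 'v cpoly" where "var v = mterm (Poly_Mapping.single v 1) 1"

lemma var_power: "var v ^ n = mterm (Poly_Mapping.single v n) 1"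
  by (induction n) (simp_all add: var_def mult_single single_add[symmetric])

lemma term_coord:
  "mterm m 1 = (var X0 ^ expo m X0 * var X1 ^ expo m X1) * (var Y0 ^ expo m Y0 * var Y1 ^ expo m Y1)"
proof -
  have "m = Poly_Mapping.single X0 (expo m X0) + Poly_Mapping.single X1 (expo m X1) +
      (Poly_Mapping.single Y0 (expo m Y0) + Poly_Mapping.single Y1 (expo m Y1))"
    by (rule poly_mapping_eqI, case_tac k) (simp_all add: lookup_add lookup_single)
  then show ?thesis by (simp add: var_power mult_single)
qed

lemma cpoly_eval_scale: "cpoly_eval c (cpoly_scale x F) = x * cpoly_eval c F"
  by (simp add: cpoly_scale_eq_mult cpoly_eval_mult cpoly_eval_term)

lemma cpoly_eval_diff: "cpoly_eval c (F - G) = cpoly_eval c F - cpoly_eval c G"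
  using cpoly_eval_add[of c "F - G" G] by simp

lemma cpoly_eval_var: "cpoly_eval c (var v) = c v"
  by (simp add: var_def cpoly_eval_term monom_val_def)

lemma lines_in_point_ideal:
  assumes "c \<in> point_coords P"
  shows "cpoly_scale (c X1) (var X0) - cpoly_scale (c X0) (var X1) \<in> point_ideal P"
    "cpoly_scale (c Y1) (var Y0) - cpoly_scale (c Y0) (var Y1) \<in> point_ideal P"
proof -
  have sub: "cpoly.subspace (bihomogeneous i j)" for i j
    by (metis cpoly.subspace_span dim_bihomogeneous_aux(4))
  have "var X0 \<in> bihomogeneous 1 0" "var X1 \<in> bihomogeneous 1 0"
    "var Y0 \<in> bihomogeneous 0 1" "var Y1 \<in> bihomogeneous 0 1"
    by (auto simp: var_def bihomogeneous_def bidegree_def lookup_single)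
  then have *: "cpoly_scale (c X1) (var X0) - cpoly_scale (c X0) (var X1) \<in> bihomogeneous 1 0"
    "cpoly_scale (c Y1) (var Y0) - cpoly_scale (c Y0) (var Y1) \<in> bihomogeneous 0 1"
    by (simp_all only: cpoly.subspace_diff[OF sub] cpoly.subspace_scale[OF sub])
  show "cpoly_scale (c X1) (var X0) - cpoly_scale (c X0) (var X1) \<in> point_ideal P"
    by (rule point_ideal_memI[OF *(1) assms])
      (simp only: cpoly_eval_diff cpoly_eval_scale cpoly_eval_var mult.commute diff_self)
  show "cpoly_scale (c Y1) (var Y0) - cpoly_scale (c Y0) (var Y1) \<in> point_ideal P"
    by (rule point_ideal_memI[OF *(2) assms])
      (simp only: cpoly_eval_diff cpoly_eval_scale cpoly_eval_var mult.commute diff_self)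
qed

text \<open>In the coordinates given by the two rulings \<open>l\<close>, \<open>l'\<close> through the point, the
  monomials with \<open>i + j \<ge> 3\<close> lie in the third power of the ideal. The others are counted
  by the given set: six in general, but only five for \<open>b = 1\<close>.\<close>

lemma codim_triple_point:
  "\<exists>k\<le>card {(i, j). i \<le> a \<and> j \<le> b \<and> i + j \<le> 2}.
     codim_le (bihomogeneous a b) (ideal_power (point_ideal P) 3) k"
proof -
  obtain c where c: "c \<in> point_coords P" using point_coords_nonempty by blast
  define l where "l = cpoly_scale (c X1) (var X0) - cpoly_scale (c X0) (var X1)"
  define l' where "l' = cpoly_scale (c Y1) (var Y0) - cpoly_scale (c Y0) (var Y1)"
  have l: "l \<in> point_ideal P" "l' \<in> point_ideal P"
    using lines_in_point_ideal[OF c] by (simp_all add: l_def l'_def)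
  obtain X where X: "var X0 \<in> cpoly.span {X, l}" "var X1 \<in> cpoly.span {X, l}"
    using linear_forms_span[OF point_coords_nonzero(1)[OF c]] unfolding l_def by blast
  obtain Y where Y: "var Y0 \<in> cpoly.span {Y, l'}" "var Y1 \<in> cpoly.span {Y, l'}"
    using linear_forms_span[OF point_coords_nonzero(2)[OF c]] unfolding l'_def by blast
  let ?J = "ideal_power (point_ideal P) 3"
  define t where "t = (\<lambda>(i, j). (l ^ i * X ^ (a - i)) * (l' ^ j * Y ^ (b - j)))"
  define K where "K = {(i, j). i \<le> a \<and> j \<le> b \<and> i + j \<le> 2}"
  have "finite K" by (rule finite_subset[of _ "{..a} \<times> {..b}"]) (auto simp: K_def)
  have tJ: "t (i, j) \<in> t ` K \<union> ?J" if "i \<le> a" "j \<le> b" for i j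
  proof (cases "i + j \<le> 2")
    case True
    then show ?thesis using that by (auto simp: K_def)
  next
    case False
    have "t (i, j) = l ^ i * (l' ^ j * (X ^ (a - i) * Y ^ (b - j)))"
      by (simp only: t_def prod.case mult.assoc mult.left_commute)
    also have "\<dots> \<in> ?J" using False by (intro ideal_power_products l) simp
    finally show ?thesis by blast
  qed
  have "mterm m 1 \<in> cpoly.span (t ` K \<union> ?J)" if "bidegree (expo m) = (a, b)" for m
  proof -
    have deg: "expo m X0 + expo m X1 = a" "expo m Y0 + expo m Y1 = b"
      using that by (auto simp: bidegree_def)
    have "mterm m 1 \<in> cpoly.span {f * g | f g. f \<in> (\<lambda>i. l ^ i * X ^ (a - i)) ` {..a} \<and>
        g \<in> (\<lambda>j. l' ^ j * Y ^ (b - j)) ` {..b}}"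
      unfolding term_coord
      using cpoly_span_mult[OF binary_forms_span[OF X, of "expo m X0" "expo m X1"]
          binary_forms_span[OF Y, of "expo m Y0" "expo m Y1"]] unfolding deg .
    also have "\<dots> \<subseteq> cpoly.span (t ` K \<union> ?J)"
    proof (intro cpoly.span_mono subsetI)
      fix f assume "f \<in> {f * g | f g. f \<in> (\<lambda>i. l ^ i * X ^ (a - i)) ` {..a} \<and>
        g \<in> (\<lambda>j. l' ^ j * Y ^ (b - j)) ` {..b}}"
      then obtain i j where "i \<le> a" "j \<le> b" "f = t (i, j)" unfolding t_def prod.case by blast
      then show "f \<in> t ` K \<union> ?J" using tJ by simp
    qed
    finally show ?thesis .
  qed
  then have "(\<lambda>m. mterm m 1) ` {m. bidegree (expo m) = (a, b)} \<subseteq> cpoly.span (t ` K \<union> ?J)" by blast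
  then have "bihomogeneous a b \<subseteq> cpoly.span (t ` K \<union> ?J)"
    using dim_bihomogeneous_aux(4)[of a b] cpoly.span_minimal[OF _ cpoly.subspace_span] by metis
  then have "codim_le (bihomogeneous a b) ?J (card (t ` K))"
    using dim_bihomogeneous_aux(1,4)[of a b] \<open>finite K\<close>
    by (intro codim_le_span[OF _ _ ideal_power_subspace]) auto
  then show ?thesis using card_image_le[OF \<open>finite K\<close>, of t] unfolding K_def by blast
qed

section \<open>Upper bounds for the Hilbert function\<close>

instantiation coord :: linorder
begin

definition less_eq_coord :: "coord \<Rightarrow> coord \<Rightarrow> bool" where
  "less_eq_coord v w \<longleftrightarrow> case_coord 0 1 2 (3 :: nat) v \<le> case_coord 0 1 2 3 w"

definition less_coord :: "coord \<Rightarrow> coord \<Rightarrow> bool" where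
  "less_coord v w \<longleftrightarrow> case_coord 0 1 2 (3 :: nat) v < case_coord 0 1 2 3 w"

instance
  by standard (auto simp: less_eq_coord_def less_coord_def split: coord.splits)

end

lemma codim_le_mono: "codim_le V W k \<Longrightarrow> k \<le> k' \<Longrightarrow> codim_le V W k'"
  unfolding codim_le_def by (meson add_left_mono order_trans)

lemma bihomogeneous_subspace: "cpoly.subspace (bihomogeneous a b)"
  by (metis cpoly.subspace_span dim_bihomogeneous_aux(4))

lemma bihomogeneous_finite_span: "\<exists>B. finite B \<and> bihomogeneous a b \<subseteq> cpoly.span B"
  by (metis dim_bihomogeneous_aux(1,4) order_refl)

lemma triple_points_ideal_subspace: "cpoly.subspace (triple_points_ideal s P)"
  unfolding triple_points_ideal_def by (intro cpoly.subspace_Inter) (auto intro: ideal_power_subspace)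

lemma bihomogeneous_mult:
  assumes "F \<in> bihomogeneous i j" "G \<in> bihomogeneous k l"
  shows "F * G \<in> bihomogeneous (i + k) (j + l)"
proof -
  have "bidegree (expo m) = (i + k, j + l)" if "m \<in> Poly_Mapping.keys (F * G)" for m
  proof -
    obtain m1 m2 where "m = m1 + m2" "m1 \<in> Poly_Mapping.keys F" "m2 \<in> Poly_Mapping.keys G"
      using \<open>m \<in> Poly_Mapping.keys (F * G)\<close> keys_mult[of F G] by blast
    then show ?thesis using assms unfolding bihomogeneous_def bidegree_def
      by (auto simp: lookup_add)
  qed
  then show ?thesis unfolding bihomogeneous_def by blast
qed

lemma dim_triple_points_ge:
  assumes "\<And>i. i < s \<Longrightarrow> codim_le (bihomogeneous a b) (ideal_power (point_ideal (P i)) 3) k"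
  shows "(a + 1) * (b + 1) \<le> cpoly.dim (triple_points_ideal s P \<inter> bihomogeneous a b) + s * k"
proof -
  have "codim_le (bihomogeneous a b) (triple_points_ideal s P) (s * k)"
    using codim_le_INT[of "{..<s}" "bihomogeneous a b" "\<lambda>i. ideal_power (point_ideal (P i)) 3" k]
      assms by (simp add: triple_points_ideal_def)
  then have "cpoly.dim (bihomogeneous a b) \<le>
      cpoly.dim (bihomogeneous a b \<inter> triple_points_ideal s P) + s * k"
    using bihomogeneous_subspace unfolding codim_le_def by blast
  then show ?thesis by (simp add: dim_bihomogeneous Int_commute)
qed

lemma hilbert_function_le_6s: "hilbert_function (triple_points_ideal s P) a b \<le> 6 * s"
proof -
  have "card {(i, j). i \<le> a \<and> j \<le> b \<and> i + j \<le> 2} \<le>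
      card {(0::nat, 0::nat), (0, 1), (0, 2), (1, 0), (1, 1), (2, 0)}"
    by (intro card_mono) auto
  also have "\<dots> = 6" by simp
  finally have "codim_le (bihomogeneous a b) (ideal_power (point_ideal (P i)) 3) 6" for i
    using codim_triple_point codim_le_mono order_trans by meson
  then show ?thesis
    using dim_triple_points_ge[of s a b P 6] by (simp add: hilbert_function_def)
qed

lemma hilbert_function_le_5s: "hilbert_function (triple_points_ideal s P) a 1 \<le> 5 * s"
proof -
  have "card {(i, j). i \<le> a \<and> j \<le> 1 \<and> i + j \<le> 2} \<le>
      card {(0::nat, 0::nat), (0, 1), (1, 0), (1, 1), (2, 0)}"
    by (intro card_mono) auto
  also have "\<dots> = 5" by simp
  finally have "codim_le (bihomogeneous a 1) (ideal_power (point_ideal (P i)) 3) 5" for i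
    using codim_triple_point codim_le_mono order_trans by meson
  then show ?thesis
    using dim_triple_points_ge[of s a 1 P 5] by (simp add: hilbert_function_def)
qed

lemma dim_curves_through_points:
  "(i + 1) * (j + 1) \<le> cpoly.dim (bihomogeneous i j \<inter> (\<Inter>t<s. point_ideal (P t))) + s"
proof -
  let ?V = "bihomogeneous i j"
  have "\<forall>t. \<exists>c. c \<in> point_coords (P t)" using point_coords_nonempty by blast
  then obtain c where c: "\<And>t. c t \<in> point_coords (P t)" by metis
  obtain B where B: "finite B" "?V \<subseteq> cpoly.span B" using bihomogeneous_finite_span by blast
  have "linear_form (cpoly_eval (c t))" for t
    by (simp add: linear_form_def cpoly_eval_add cpoly_eval_scale)
  then have "codim_le ?V {f. cpoly_eval (c t) f = 0} 1" for t
    by (rule codim_le_kernel[OF B(2,1)])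
  then have "codim_le ?V (\<Inter>t\<in>{..<s}. {f. cpoly_eval (c t) f = 0}) (card {..<s} * 1)"
    by (intro codim_le_INT) auto
  then have "cpoly.dim ?V \<le> cpoly.dim (?V \<inter> (\<Inter>t<s. {f. cpoly_eval (c t) f = 0})) + card {..<s} * 1"
    using bihomogeneous_subspace unfolding codim_le_def by blast
  also have "?V \<inter> (\<Inter>t<s. {f. cpoly_eval (c t) f = 0}) = ?V \<inter> (\<Inter>t<s. point_ideal (P t))"
  proof (rule equalityI; rule subsetI)
    fix f assume f: "f \<in> ?V \<inter> (\<Inter>t<s. {f. cpoly_eval (c t) f = 0})"
    then have "f \<in> point_ideal (P t)" if "t < s" for t
      using that by (intro point_ideal_memI[OF _ c]) auto
    with f show "f \<in> ?V \<inter> (\<Inter>t<s. point_ideal (P t))" by blast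
  next
    fix f assume f: "f \<in> ?V \<inter> (\<Inter>t<s. point_ideal (P t))"
    then have "cpoly_eval (c t) f = 0" if "t < s" for t
      using that by (intro point_ideal_eval[OF _ c]) auto
    with f show "f \<in> ?V \<inter> (\<Inter>t<s. {f. cpoly_eval (c t) f = 0})" by blast
  qed
  finally show ?thesis by (simp add: dim_bihomogeneous)
qed

text \<open>Multiplication by a nonzero polynomial is injective.\<close>

lemma dim_le_if_mult:
  assumes "finite B" "W' \<subseteq> cpoly.span B" and C: "(C :: coord cpoly) \<noteq> 0"
    and CW: "\<And>f. f \<in> W \<Longrightarrow> C * f \<in> W'"
  shows "cpoly.dim W \<le> cpoly.dim W'"
proof -
  obtain X where X: "X \<subseteq> W" "cpoly.independent X" "W \<subseteq> cpoly.span X" "card X = cpoly.dim W"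
    by (rule cpoly.basis_exists[of W])
  obtain Y where Y: "Y \<subseteq> W'" "cpoly.independent Y" "W' \<subseteq> cpoly.span Y" "card Y = cpoly.dim W'"
    by (rule cpoly.basis_exists[of W'])
  have "finite Y" using cpoly.independent_span_bound[OF assms(1) Y(2) order_trans[OF Y(1) assms(2)]] by blast
  have inj: "inj ((*) C)" using C by (simp add: inj_on_def)
  have "Vector_Spaces.linear cpoly_scale cpoly_scale ((*) C)"
    by unfold_locales (simp_all only: distrib_left cpoly_scale_mult_right)
  then have "cpoly.independent ((*) C ` X)"
    by (rule vector_space_pair.linear_independent_injective_image[OF
        vector_space_pair.intro[OF cpoly.vector_space_axioms cpoly.vector_space_axioms] _ X(2) inj_on_subset[OF inj subset_UNIV]])
  moreover have "(*) C ` X \<subseteq> cpoly.span Y"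
  proof (intro image_subsetI)
    fix f assume "f \<in> X"
    then have "C * f \<in> W'" using X(1) by (intro CW) blast
    then show "C * f \<in> cpoly.span Y" using Y(3) by blast
  qed
  ultimately have "card ((*) C ` X) \<le> card Y"
    using cpoly.independent_span_bound[OF \<open>finite Y\<close>] by blast
  moreover have "card ((*) C ` X) = card X"
    by (rule card_image, rule inj_on_subset[OF inj subset_UNIV])
  ultimately show ?thesis using X(4) Y(4) by simp
qed

text \<open>The source of the forms that the count of conditions does not predict: \<open>C\<^sup>2 D\<close> is
  triple at each point through which both \<open>C\<close> and \<open>D\<close> pass, and
  \<open>D\<close> varies in a space of dimension at least \<open>(k + 1) (l + 1) - s\<close>.\<close>

lemma dim_double_curve:
  assumes "s < (i + 1) * (j + 1)"
  shows "(k + 1) * (l + 1) \<le>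
    cpoly.dim (triple_points_ideal s P \<inter> bihomogeneous (i + i + k) (j + j + l)) + s"
proof -
  let ?W = "\<lambda>i j. bihomogeneous i j \<inter> (\<Inter>t<s. point_ideal (P t))"
  have "cpoly.dim (?W i j) \<noteq> 0" using dim_curves_through_points[where i = i and j = j and s = s and P = P] assms by linarith
  moreover have "cpoly.dim {0 :: coord cpoly} \<le> card ({} :: coord cpoly set)"
    by (rule cpoly.dim_le_card) auto
  ultimately have "\<not> ?W i j \<subseteq> {0}"
    using cpoly.dim_le_card[of "?W i j" "{}"] by auto
  then obtain C where C: "C \<noteq> 0" "C \<in> ?W i j" by blast
  obtain B where B: "finite B" "bihomogeneous (i + i + k) (j + j + l) \<subseteq> cpoly.span B"
    using bihomogeneous_finite_span by blast
  have "cpoly.dim (?W k l) \<le>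
      cpoly.dim (triple_points_ideal s P \<inter> bihomogeneous (i + i + k) (j + j + l))"
  proof (rule dim_le_if_mult[OF B(1)])
    show "C * C \<noteq> 0" using C(1) by simp
    show "triple_points_ideal s P \<inter> bihomogeneous (i + i + k) (j + j + l) \<subseteq> cpoly.span B"
      using B(2) by blast
    fix D assume D: "D \<in> ?W k l"
    have "C * C * D \<in> bihomogeneous (i + i + k) (j + j + l)"
      using C D by (intro bihomogeneous_mult) auto
    moreover have "C * C * D \<in> ideal_power (point_ideal (P t)) 3" if "t < s" for t
    proof -
      have "C * (C * (D * 1)) \<in> ideal_power (point_ideal (P t)) (Suc (Suc (Suc 0)))"
        using C(2) D that by (intro ideal_power_SucI) auto
      then show ?thesis by (simp only: mult_1_right mult.assoc numeral_3_eq_3)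
    qed
    ultimately show "C * C * D \<in> triple_points_ideal s P \<inter> bihomogeneous (i + i + k) (j + j + l)"
      unfolding triple_points_ideal_def by blast
  qed
  then show ?thesis using dim_curves_through_points[where i = k and j = l and s = s and P = P] by linarith
qed

text \<open>The exceptional curve \<open>C\<close> has bi-degree \<open>(k, 1)\<close> and passes through \<open>2 k
  + 1\<close> points; on the blow-up it is a curve of self-intersection \<open>-1\<close>. The residual
  curve \<open>D\<close> consists of the fibres through the points in bi-degree \<open>(4 k + 1,
  2)\<close>, may be taken to be \<open>C\<close> itself in bi-degree \<open>(3 k, 3)\<close>, and moves
  in a space of dimension at least three in bi-degree \<open>(3 k + 1, 3)\<close>. In bi-degree
  \<open>(5, 4)\<close> the curves \<open>C\<close> and \<open>D\<close> have bi-degrees \<open>(2,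
  1)\<close> and \<open>(1, 2)\<close>.\<close>

lemma hilbert_function_le_general_value:
  assumes "a \<ge> b" "b \<ge> 1"
  shows "hilbert_function (triple_points_ideal s P) a b \<le> general_value a b s"
proof -
  let ?N = "(a + 1) * (b + 1)"
  let ?HF = "hilbert_function (triple_points_ideal s P) a b"
  have generic: "?HF \<le> min ?N (6 * s)"
    using hilbert_function_le_6s[of s P a b] by (simp add: hilbert_function_def)
  have special: "?HF \<le> ?N - ((k + 1) * (l + 1) - s)"
    if "s < (i + 1) * (j + 1)" "a = i + i + k" "b = j + j + l" for i j k l
    using dim_double_curve[OF that(1), of k l P] that(2,3) unfolding hilbert_function_def by simp
  consider "b = 1" "real s < 2 / 5 * (real a + 1)"
    | k where "s = 2 * k + 1" "a = 4 * k + 1" "b = 2"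
    | k where "s = 2 * k + 1" "a = 3 * k" "b = 3"
    | k where "s = 2 * k + 1" "a = 3 * k + 1" "b = 3"
    | "s = 5" "a = 5" "b = 4"
    | "general_value a b s = min ?N (6 * s)"
  proof -
    have "b = 1 \<and> real s < 2 / 5 * (real a + 1) \<or> (\<exists>k. s = 2 * k + 1 \<and> a = 4 * k + 1 \<and> b = 2) \<or>
        (\<exists>k. s = 2 * k + 1 \<and> a = 3 * k \<and> b = 3) \<or> (\<exists>k. s = 2 * k + 1 \<and> a = 3 * k + 1 \<and> b = 3) \<or>
        s = 5 \<and> a = 5 \<and> b = 4 \<or> general_value a b s = min ?N (6 * s)"
      unfolding general_value_def prod.inject by (simp only: split: if_split) blast
    then show ?thesis using that by blast
  qed
  then show ?thesis
  proof cases
    case 1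
    then show ?thesis using hilbert_function_le_5s[of s P a] by (simp add: general_value_def)
  next
    case (2 k)
    have "?HF \<le> ?N - 1" using special[of k 1 "2 * k + 1" 0] 2 by simp
    moreover have "general_value a b s = ?N - 1" using 2 by (auto simp: general_value_def)
    ultimately show ?thesis by simp
  next
    case (3 k)
    have "?HF \<le> ?N - 1" using special[of k 1 k 1] 3 by simp
    moreover have "general_value a b s = ?N - 1" using 3 by (auto simp: general_value_def)
    ultimately show ?thesis by simp
  next
    case (4 k)
    have "?HF \<le> ?N - 3" using special[of k 1 "k + 1" 1] 4 by simp
    also have "?N - 3 = 6 * s - 1" using 4 by simp
    also have "3 * k + 1 \<noteq> 3 * k'" for k' by presburger
    then have "6 * s - 1 = general_value a b s" using 4 by (auto simp: general_value_def)
    finally show ?thesis .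
  next
    case 5
    then show ?thesis using special[of 2 1 1 2] by (simp add: general_value_def)
  next
    case 6
    then show ?thesis using generic by simp
  qed
qed

section \<open>Lower bounds for the Hilbert function in general position\<close>

text \<open>The bi-homogeneous monomial with affine exponent \<open>e\<close>. The renaming \<open>h\<close> of the
  variables serves the identity as well as the embedding \<open>v \<mapsto> (i, v)\<close> into the
  coordinates of the \<open>i\<close>-th point.\<close>

definition grid_monom :: "(coord \<Rightarrow> 'v) \<Rightarrow> nat \<Rightarrow> nat \<Rightarrow> int \<times> int \<Rightarrow> 'v \<Rightarrow>\<^sub>0 nat" where
  "grid_monom h a b e =
     Poly_Mapping.single (h X0) (a - nat (fst e)) + Poly_Mapping.single (h X1) (nat (fst e)) +
     Poly_Mapping.single (h Y0) (b - nat (snd e)) + Poly_Mapping.single (h Y1) (nat (snd e))"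

lemma monom_val_single: "monom_val c (Poly_Mapping.single v n) = c v ^ n"
  by (simp add: monom_val_def)

lemma monom_val_grid_monom:
  "monom_val c (grid_monom h a b e) = c (h X0) ^ (a - nat (fst e)) * c (h X1) ^ nat (fst e) *
     c (h Y0) ^ (b - nat (snd e)) * c (h Y1) ^ nat (snd e)"
  unfolding grid_monom_def monom_val_add monom_val_single ..

lemma expo_grid_monom:
  "expo (grid_monom (\<lambda>v. v) a b e) X0 = a - nat (fst e)" "expo (grid_monom (\<lambda>v. v) a b e) X1 = nat (fst e)"
  "expo (grid_monom (\<lambda>v. v) a b e) Y0 = b - nat (snd e)" "expo (grid_monom (\<lambda>v. v) a b e) Y1 = nat (snd e)"
  by (simp_all add: grid_monom_def lookup_add lookup_single)

lemma grid_monom_inj: "inj_on (grid_monom (\<lambda>v. v) a b) (rect A B)"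
proof (rule inj_onI)
  fix d e assume "d \<in> rect A B" "e \<in> rect A B" "grid_monom (\<lambda>v. v) a b d = grid_monom (\<lambda>v. v) a b e"
  then have "nat (fst d) = nat (fst e)" "nat (snd d) = nat (snd e)" "0 \<le> fst d" "0 \<le> snd d" "0 \<le> fst e" "0 \<le> snd e"
    by (auto simp: rect_def) (metis expo_grid_monom(2) fst_conv, metis expo_grid_monom(4) snd_conv)
  then show "d = e" by (simp add: prod_eq_iff eq_nat_nat_iff)
qed

lemma bihomogeneous_keys:
  assumes "f \<in> bihomogeneous a b"
  shows "Poly_Mapping.keys f \<subseteq> grid_monom (\<lambda>v. v) a b ` rect (a + 1) (b + 1)"
proof
  fix m assume "m \<in> Poly_Mapping.keys f"
  then have m: "expo m X0 + expo m X1 = a" "expo m Y0 + expo m Y1 = b"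
    using assms by (auto simp: bihomogeneous_def bidegree_def)
  have "m = grid_monom (\<lambda>v. v) a b (int (expo m X1), int (expo m Y1))"
  proof (rule poly_mapping_eqI)
    fix v show "expo m v = expo (grid_monom (\<lambda>v. v) a b (int (expo m X1), int (expo m Y1))) v"
      by (cases v) (use m in \<open>auto simp: expo_grid_monom\<close>)
  qed
  moreover have "(int (expo m X1), int (expo m Y1)) \<in> rect (a + 1) (b + 1)"
    using m by (auto simp: rect_def)
  ultimately show "m \<in> grid_monom (\<lambda>v. v) a b ` rect (a + 1) (b + 1)" by blast
qed

text \<open>A basis of the quadratic polynomials in the exponent.\<close>

definition jet :: "nat \<Rightarrow> int \<times> int \<Rightarrow> complex" where
  "jet r e = [1, of_int (fst e), of_int (snd e), of_int (fst e) ^ 2,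
     of_int (fst e) * of_int (snd e), of_int (snd e) ^ 2] ! r"

lemma determining_jets:
  assumes "determining p n C"
    and "\<And>i r. i < n \<Longrightarrow> r < 6 \<Longrightarrow> (\<Sum>e\<in>C. g e * (jet r e * monom_at (p i) e)) = 0"
  shows "\<forall>e\<in>C. g e = 0"
proof (rule determiningD[OF assms(1)])
  fix i q assume i: "i < n" and "quadratic q"
  then obtain k a b c d l where q: "\<And>u v. q (u, v) = k + a * of_int u + b * of_int v + c * of_int u ^ 2
      + d * of_int u * of_int v + l * of_int v ^ 2"
    unfolding quadratic_def by blast
  let ?c = "\<lambda>r. [k, a, b, c, d, l] ! r"
  have "q e = (\<Sum>r<6. ?c r * jet r e)" for e
    using q[of "fst e" "snd e"] by (simp add: jet_def eval_nat_numeral)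
  then have "(\<Sum>e\<in>C. g e * (q e * monom_at (p i) e)) =
      (\<Sum>e\<in>C. \<Sum>r<6. ?c r * (g e * (jet r e * monom_at (p i) e)))"
    by (simp only: sum_distrib_left sum_distrib_right mult.assoc mult.left_commute)
  also have "\<dots> = (\<Sum>r<6. ?c r * (\<Sum>e\<in>C. g e * (jet r e * monom_at (p i) e)))"
    unfolding sum_distrib_left by (rule sum.swap)
  also have "\<dots> = 0" by (rule sum.neutral) (use assms(2)[OF i] in simp)
  finally show "(\<Sum>e\<in>C. g e * (q e * monom_at (p i) e)) = 0" .
qed

lemma euler_eval_sum:
  assumes "finite C" "C \<subseteq> rect A B" "Poly_Mapping.keys f \<subseteq> grid_monom (\<lambda>v. v) a b ` C"
    and "\<And>m. coeff_of g m = w m * coeff_of f m"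
  shows "cpoly_eval c g = (\<Sum>e\<in>C. coeff_of f (grid_monom (\<lambda>v. v) a b e) *
    (w (grid_monom (\<lambda>v. v) a b e) * monom_val c (grid_monom (\<lambda>v. v) a b e)))"
proof -
  have "Poly_Mapping.keys g \<subseteq> Poly_Mapping.keys f"
    using assms(4) by (auto simp: in_keys_iff)
  then have "Poly_Mapping.keys g \<subseteq> grid_monom (\<lambda>v. v) a b ` C" using assms(3) by (rule order_trans)
  then have "cpoly_eval c g = (\<Sum>m\<in>grid_monom (\<lambda>v. v) a b ` C. coeff_of g m * monom_val c m)"
    by (intro cpoly_eval_superset) (use assms(1) in simp)
  also have "\<dots> = (\<Sum>e\<in>C. coeff_of g (grid_monom (\<lambda>v. v) a b e) * monom_val c (grid_monom (\<lambda>v. v) a b e))"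
    by (rule sum.reindex_cong[OF inj_on_subset[OF grid_monom_inj assms(2)] refl refl])
  finally show ?thesis by (simp only: assms(4) mult.assoc mult.left_commute)
qed

text \<open>The easy direction of the description of \<open>\<wp>\<^sup>3\<close> by derivatives: the values at the
  point of the form and of its first and second Euler derivatives in \<open>X1\<close> and
  \<open>Y1\<close> vanish. It holds for arbitrary coordinate vectors, zeros included.\<close>

lemma triple_point_jets:
  assumes f: "f \<in> ideal_power (point_ideal P) 3" and c: "c \<in> point_coords P"
    and C: "finite C" "C \<subseteq> rect A B" "Poly_Mapping.keys f \<subseteq> grid_monom (\<lambda>v. v) a b ` C"
    and "r < 6"
  shows "(\<Sum>e\<in>C. coeff_of f (grid_monom (\<lambda>v. v) a b e) *
    (jet r e * monom_val c (grid_monom (\<lambda>v. v) a b e))) = 0"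
proof -
  let ?x = "\<lambda>m. of_nat (expo m X1) :: complex" and ?y = "\<lambda>m. of_nat (expo m Y1) :: complex"
  let ?J = "ideal_power (point_ideal P)"
  have f3: "f \<in> ?J (Suc (Suc (Suc 0)))" using f by (simp only: numeral_3_eq_3)
  have e1: "euler v f \<in> ?J (Suc (Suc 0))" for v by (rule euler_ideal_power[OF f3])
  have e2: "euler w (euler v f) \<in> ?J (Suc 0)" for v w by (rule euler_ideal_power[OF e1])
  have vanish: "(\<Sum>e\<in>C. coeff_of f (grid_monom (\<lambda>v. v) a b e) *
      (w (grid_monom (\<lambda>v. v) a b e) * monom_val c (grid_monom (\<lambda>v. v) a b e))) = 0"
    if "\<And>m. coeff_of g m = w m * coeff_of f m" "g \<in> ?J (Suc n)" for g w n
    using euler_eval_sum[OF C that(1), of c] ideal_power_Suc_eval[OF that(2) c] by simp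
  have jet: "jet 0 e = 1" "jet 1 e = ?x (grid_monom (\<lambda>v. v) a b e)" "jet 2 e = ?y (grid_monom (\<lambda>v. v) a b e)"
    "jet 3 e = ?x (grid_monom (\<lambda>v. v) a b e) * ?x (grid_monom (\<lambda>v. v) a b e)"
    "jet 4 e = ?x (grid_monom (\<lambda>v. v) a b e) * ?y (grid_monom (\<lambda>v. v) a b e)"
    "jet 5 e = ?y (grid_monom (\<lambda>v. v) a b e) * ?y (grid_monom (\<lambda>v. v) a b e)" if "e \<in> C" for e
    using that C(2) by (auto simp: jet_def expo_grid_monom rect_def power2_eq_square of_nat_nat)
  consider "r = 0" | "r = 1" | "r = 2" | "r = 3" | "r = 4" | "r = 5" using \<open>r < 6\<close> by linarith
  then show ?thesis
  proof cases
    case 1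
    show ?thesis using vanish[of f "\<lambda>_. 1", OF _ f3] by (simp add: 1 jet(1) cong: sum.cong)
  next
    case 2
    show ?thesis using vanish[OF lookup_euler e1, of X1] by (simp add: 2 jet(2)[simplified] cong: sum.cong)
  next
    case 3
    show ?thesis using vanish[OF lookup_euler e1, of Y1] by (simp add: 3 jet(3) cong: sum.cong)
  next
    case 4
    have "coeff_of (euler X1 (euler X1 f)) m = ?x m * ?x m * coeff_of f m" for m
      by (simp only: lookup_euler mult.assoc)
    from vanish[OF this e2] show ?thesis by (simp add: 4 jet(4) cong: sum.cong)
  next
    case 5
    have "coeff_of (euler X1 (euler Y1 f)) m = ?x m * ?y m * coeff_of f m" for m
      by (simp only: lookup_euler mult.assoc)
    from vanish[OF this e2] show ?thesis by (simp add: 5 jet(5) cong: sum.cong)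
  next
    case 6
    have "coeff_of (euler Y1 (euler Y1 f)) m = ?y m * ?y m * coeff_of f m" for m
      by (simp only: lookup_euler mult.assoc)
    from vanish[OF this e2] show ?thesis by (simp add: 6 jet(6) cong: sum.cong)
  qed
qed

text \<open>If \<open>W\<close> contains no nonzero form with support in \<open>C\<close>, then the coefficients at
  the monomials outside \<open>C\<close> are enough to distinguish the elements of \<open>W\<close>.\<close>

lemma dim_le_complement:
  assumes W: "cpoly.subspace W" "W \<subseteq> bihomogeneous a b" and C: "C \<subseteq> rect (a + 1) (b + 1)"
    and zero: "\<And>f. f \<in> W \<Longrightarrow> Poly_Mapping.keys f \<subseteq> grid_monom (\<lambda>v. v) a b ` C \<Longrightarrow> f = 0"
  shows "cpoly.dim W + card C \<le> (a + 1) * (b + 1)"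
proof -
  let ?R = "rect (a + 1) (b + 1)"
  have fin: "finite ?R" by (simp add: rect_def)
  obtain B where B: "finite B" "bihomogeneous a b \<subseteq> cpoly.span B" using bihomogeneous_finite_span by blast
  define ker where "ker e = {f. coeff_of f (grid_monom (\<lambda>v. v) a b e) = 0}" for e
  have "linear_form (\<lambda>f. coeff_of f m)" for m :: "coord \<Rightarrow>\<^sub>0 nat"
    by (simp add: linear_form_def lookup_add)
  then have "codim_le (bihomogeneous a b) (ker e) 1" for e
    unfolding ker_def by (rule codim_le_kernel[OF B(2,1)])
  then have "codim_le (bihomogeneous a b) (\<Inter>e\<in>?R - C. ker e) (card (?R - C) * 1)"
    using fin by (intro codim_le_INT) auto
  then have "cpoly.dim W \<le> cpoly.dim (W \<inter> (\<Inter>e\<in>?R - C. ker e)) + card (?R - C) * 1"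
    using W unfolding codim_le_def by blast
  also have "W \<inter> (\<Inter>e\<in>?R - C. ker e) \<subseteq> {0}"
  proof
    fix f assume f: "f \<in> W \<inter> (\<Inter>e\<in>?R - C. ker e)"
    have "Poly_Mapping.keys f \<subseteq> grid_monom (\<lambda>v. v) a b ` C"
    proof
      fix m assume m: "m \<in> Poly_Mapping.keys f"
      have "f \<in> bihomogeneous a b" using f W(2) by blast
      then obtain e where e: "e \<in> ?R" "m = grid_monom (\<lambda>v. v) a b e"
        using m bihomogeneous_keys by blast
      have "e \<in> C"
      proof (rule ccontr)
        assume "e \<notin> C"
        then have "f \<in> ker e" using f e(1) by blast
        then show False using m e(2) by (simp add: ker_def in_keys_iff)
      qed
      then show "m \<in> grid_monom (\<lambda>v. v) a b ` C" using e(2) by blast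
    qed
    then show "f \<in> {0}" using zero f by blast
  qed
  then have "cpoly.dim (W \<inter> (\<Inter>e\<in>?R - C. ker e)) \<le> card ({} :: coord cpoly set)"
    by (intro cpoly.dim_le_card) auto
  finally have "cpoly.dim W \<le> card (?R - C)" by simp
  moreover have "card (?R - C) = card ?R - card C" using C by (intro card_Diff_subset finite_subset[OF C fin])
  moreover have "card C \<le> card ?R" by (rule card_mono[OF fin C])
  ultimately show ?thesis by (simp add: card_rect)
qed

text \<open>A maximal minor of a matrix of full column rank, found one column at a time: as a function of the new
  row, the determinant is a linear form whose coefficients are cofactors, and the last of these is the
  minor found before; so some row of the matrix does not annihilate it.\<close>

lemma nonsingular_rows:
  fixes \<rho> :: "'r \<Rightarrow> nat \<Rightarrow> complex"
  assumes "\<And>g. (\<And>r. r \<in> R \<Longrightarrow> (\<Sum>j<n. g j * \<rho> r j) = 0) \<Longrightarrow> \<forall>j<n. g j = 0"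
  shows "\<exists>\<sigma>. (\<forall>i<n. \<sigma> i \<in> R) \<and> det (mat n n (\<lambda>(i, j). \<rho> (\<sigma> i) j)) \<noteq> 0"
  using assms
proof (induction n)
  case 0
  show ?case by (simp add: det_dim_zero)
next
  case (Suc n)
  have "\<exists>\<sigma>. (\<forall>i<n. \<sigma> i \<in> R) \<and> det (mat n n (\<lambda>(i, j). \<rho> (\<sigma> i) j)) \<noteq> 0"
  proof (rule Suc.IH)
    fix g assume g: "\<And>r. r \<in> R \<Longrightarrow> (\<Sum>j<n. g j * \<rho> r j) = 0"
    have "\<forall>j<Suc n. (g(n := 0)) j = 0" by (rule Suc.prems) (simp add: g)
    then have "(g(n := 0)) j = 0" if "j < n" for j using that by (metis less_SucI)
    then show "\<forall>j<n. g j = 0" by simp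
  qed
  then obtain \<sigma> where \<sigma>: "\<forall>i<n. \<sigma> i \<in> R" "det (mat n n (\<lambda>(i, j). \<rho> (\<sigma> i) j)) \<noteq> 0" by blast
  define A where "A r = mat (Suc n) (Suc n) (\<lambda>(i, j). \<rho> (if i < n then \<sigma> i else r) j)" for r
  define cof where "cof j = cofactor (A undefined) n j" for j
  have A: "A r \<in> carrier_mat (Suc n) (Suc n)" for r by (simp add: A_def)
  have delete: "mat_delete (A r) n j = mat_delete (A undefined) n j" if "j \<le> n" for r j
    by (rule eq_matI) (auto simp: mat_delete_def A_def)
  have expand: "det (A r) = (\<Sum>j<Suc n. cof j * \<rho> r j)" for r
  proof -
    have "det (A r) = (\<Sum>j<Suc n. A r $$ (n, j) * cofactor (A r) n j)"
      by (rule laplace_expansion_row[OF A]) simp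
    also have "\<dots> = (\<Sum>j<Suc n. cof j * \<rho> r j)"
    proof (rule sum.cong[OF refl])
      fix j assume "j \<in> {..<Suc n}"
      then have j: "j \<le> n" by simp
      have "cofactor (A r) n j = cof j" unfolding cofactor_def cof_def delete[OF j, of r] ..
      moreover have "A r $$ (n, j) = \<rho> r j" using j by (simp add: A_def)
      ultimately show "A r $$ (n, j) * cofactor (A r) n j = cof j * \<rho> r j" by (simp only: mult.commute)
    qed
    finally show ?thesis .
  qed
  have "mat_delete (A undefined) n n = mat n n (\<lambda>(i, j). \<rho> (\<sigma> i) j)"
    by (rule eq_matI) (auto simp: mat_delete_def A_def)
  then have "cof n \<noteq> 0" using \<sigma>(2) by (simp add: cof_def cofactor_def)
  then obtain r where r: "r \<in> R" "(\<Sum>j<Suc n. cof j * \<rho> r j) \<noteq> 0"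
    using Suc.prems[of cof] by blast
  define \<sigma>' where "\<sigma>' i = (if i < n then \<sigma> i else r)" for i
  have "det (mat (Suc n) (Suc n) (\<lambda>(i, j). \<rho> (\<sigma>' i) j)) \<noteq> 0"
    using r(2) expand[of r] unfolding A_def \<sigma>'_def by simp
  moreover have "\<forall>i<Suc n. \<sigma>' i \<in> R" using \<sigma>(1) r(1) by (auto simp: \<sigma>'_def)
  ultimately show ?case by blast
qed

text \<open>Multihomogeneity with the degrees as arguments, so that they can be followed through the expansion of a
  determinant.\<close>

definition has_multidegree ::
  "nat \<Rightarrow> (nat \<Rightarrow> nat) \<Rightarrow> (nat \<Rightarrow> nat) \<Rightarrow> (nat \<times> coord) cpoly \<Rightarrow> bool" where
  "has_multidegree s d d' F \<longleftrightarrow> (\<forall>m\<in>Poly_Mapping.keys F. Poly_Mapping.keys m \<subseteq> {..<s} \<times> UNIV \<and>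
     (\<forall>i<s. bidegree (\<lambda>v. expo m (i, v)) = (d i, d' i)))"

lemma has_multidegree_add:
  "has_multidegree s d d' F \<Longrightarrow> has_multidegree s d d' G \<Longrightarrow> has_multidegree s d d' (F + G)"
  unfolding has_multidegree_def using keys_add[of F G] by blast

lemma has_multidegree_zero: "has_multidegree s d d' 0"
  by (simp add: has_multidegree_def)

lemma has_multidegree_sum:
  assumes "finite K" "\<And>k. k \<in> K \<Longrightarrow> has_multidegree s d d' (F k)"
  shows "has_multidegree s d d' (\<Sum>k\<in>K. F k)"
  using assms by (induction K) (auto intro: has_multidegree_add has_multidegree_zero)

lemma has_multidegree_mult:
  assumes "has_multidegree s d d' F" "has_multidegree s e e' G"
  shows "has_multidegree s (\<lambda>i. d i + e i) (\<lambda>i. d' i + e' i) (F * G)"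
  unfolding has_multidegree_def
proof
  fix m assume "m \<in> Poly_Mapping.keys (F * G)"
  then obtain m1 m2 where m: "m = m1 + m2" "m1 \<in> Poly_Mapping.keys F" "m2 \<in> Poly_Mapping.keys G"
    using keys_mult[of F G] by blast
  have 1: "Poly_Mapping.keys m1 \<subseteq> {..<s} \<times> UNIV"
    "\<And>i. i < s \<Longrightarrow> bidegree (\<lambda>v. expo m1 (i, v)) = (d i, d' i)"
    using assms(1) m(2) unfolding has_multidegree_def by blast+
  have 2: "Poly_Mapping.keys m2 \<subseteq> {..<s} \<times> UNIV"
    "\<And>i. i < s \<Longrightarrow> bidegree (\<lambda>v. expo m2 (i, v)) = (e i, e' i)"
    using assms(2) m(3) unfolding has_multidegree_def by blast+
  have "Poly_Mapping.keys m \<subseteq> {..<s} \<times> UNIV"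
    unfolding m(1) using keys_add[of m1 m2] 1(1) 2(1) by blast
  moreover have "bidegree (\<lambda>v. expo m (i, v)) = (d i + e i, d' i + e' i)" if "i < s" for i
    using 1(2)[OF that] 2(2)[OF that] unfolding bidegree_def m(1) lookup_add by simp
  ultimately show "Poly_Mapping.keys m \<subseteq> {..<s} \<times> UNIV \<and>
      (\<forall>i<s. bidegree (\<lambda>v. expo m (i, v)) = (d i + e i, d' i + e' i))" by blast
qed

lemma has_multidegree_one: "has_multidegree s (\<lambda>_. 0) (\<lambda>_. 0) 1"
  by (simp add: has_multidegree_def single_one[symmetric] bidegree_def del: single_one)

lemma has_multidegree_uminus: "has_multidegree s d d' F \<Longrightarrow> has_multidegree s d d' (- F)"
  by (simp add: has_multidegree_def in_keys_iff)

lemma has_multidegree_prod: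
  assumes "finite K" "\<And>k. k \<in> K \<Longrightarrow> has_multidegree s (d k) (d' k) (F k)"
  shows "has_multidegree s (\<lambda>i. \<Sum>k\<in>K. d k i) (\<lambda>i. \<Sum>k\<in>K. d' k i) (\<Prod>k\<in>K. F k)"
  using assms
proof (induction K)
  case empty
  then show ?case using has_multidegree_one by simp
next
  case (insert k K)
  have "has_multidegree s (\<lambda>i. d k i + (\<Sum>k\<in>K. d k i)) (\<lambda>i. d' k i + (\<Sum>k\<in>K. d' k i))
      (F k * (\<Prod>k\<in>K. F k))"
    using insert by (intro has_multidegree_mult) auto
  then show ?case using insert.hyps by simp
qed

lemma has_multidegree_entry:
  assumes "i < s" "e \<in> rect (a + 1) (b + 1)"
  shows "has_multidegree s (\<lambda>j. if j = i then a else 0) (\<lambda>j. if j = i then b else 0)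
    (mterm (grid_monom (Pair i) a b e) x)"
proof -
  have "Poly_Mapping.keys (grid_monom (Pair i) a b e) \<subseteq> {i} \<times> UNIV"
    by (auto simp: grid_monom_def in_keys_iff lookup_add lookup_single when_def split: if_splits)
  moreover have "bidegree (\<lambda>v. expo (grid_monom (Pair i) a b e) (j, v)) = (if j = i then (a, b) else (0, 0))" for j
    using assms(2) by (auto simp: bidegree_def grid_monom_def lookup_add lookup_single rect_def)
  ultimately show ?thesis using assms(1) unfolding has_multidegree_def by (auto split: if_splits)
qed

lemma has_multidegree_det:
  fixes A :: "(nat \<times> coord) cpoly mat"
  assumes "A \<in> carrier_mat n n"
    and "\<And>k j. k < n \<Longrightarrow> j < n \<Longrightarrow> has_multidegree s (d k) (d' k) (A $$ (k, j))"
  shows "has_multidegree s (\<lambda>i. \<Sum>k<n. d k i) (\<lambda>i. \<Sum>k<n. d' k i) (det A)"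
  unfolding det_def'[OF assms(1)]
proof (rule has_multidegree_sum)
  fix p assume "p \<in> {p. p permutes {0..<n}}"
  then have p: "p k < n" if "k < n" for k using that permutes_in_image[of p "{0..<n}" k] by auto
  have prod: "has_multidegree s (\<lambda>i. \<Sum>k<n. d k i) (\<lambda>i. \<Sum>k<n. d' k i) (\<Prod>k=0..<n. A $$ (k, p k))"
    unfolding atLeast0LessThan by (rule has_multidegree_prod) (use assms(2) p in auto)
  show "has_multidegree s (\<lambda>i. \<Sum>k<n. d k i) (\<lambda>i. \<Sum>k<n. d' k i)
      (signof p * (\<Prod>k=0..<n. A $$ (k, p k)))"
    using prod has_multidegree_uminus[OF prod] by (cases "evenperm p") (simp_all add: sign_def)
qed (simp add: finite_permutations)

lemma cpoly_eval_det:
  assumes "A \<in> carrier_mat n n"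
  shows "cpoly_eval c (det A) = det (map_mat (cpoly_eval c) A)"
proof -
  interpret comm_ring_hom "cpoly_eval c"
    by unfold_locales (simp_all add: cpoly_eval_add cpoly_eval_mult)
  show ?thesis by simp
qed

lemma monom_val_torus:
  assumes "e \<in> rect (a + 1) (b + 1)"
    and "c (h X0) = 1" "c (h X1) = fst z" "c (h Y0) = 1" "c (h Y1) = snd z"
  shows "monom_val c (grid_monom h a b e) = monom_at z e"
  using assms by (auto simp: monom_val_grid_monom monom_at_def rect_def power_int_def)

text \<open>Semicontinuity. A maximal minor of the matrix of conditions on the monomials in \<open>C\<close> is a
  multihomogeneous polynomial in the coordinates of the points. It is nonzero at the given torus points,
  and wherever it is nonzero no nonzero form with support in \<open>C\<close> is triple at all the
  points.\<close>

lemma independent_conditions_general: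
  assumes C: "C \<subseteq> rect (a + 1) (b + 1)" and "determined s C"
  shows "\<exists>U. zariski_open s U \<and> U \<noteq> {} \<and>
    (\<forall>P\<in>U. card C \<le> hilbert_function (triple_points_ideal s P) a b)"
proof -
  obtain p where p: "determining p s C" and fin: "finite C" using assms(2) unfolding determined_def by blast
  obtain es where es: "set es = C" "distinct es" using finite_distinct_list[OF fin] by blast
  define n where "n = length es"
  have n: "card C = n" using es by (metis distinct_card n_def)
  have es_in: "es ! j \<in> C" if "j < n" for j using that es(1) by (auto simp: n_def)
  have sum_es: "(\<Sum>e\<in>C. w e) = (\<Sum>j<n. w (es ! j))" for w :: "_ \<Rightarrow> complex"
  proof -
    have "bij_betw ((!) es) {..<n} C" using es bij_betw_nth[of es "{..<n}" C] by (simp add: n_def)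
    then show ?thesis by (simp add: sum.reindex_bij_betw[symmetric])
  qed
  define \<rho> where "\<rho> = (\<lambda>(i, r) j. jet r (es ! j) * monom_at (p i) (es ! j))"
  have "\<exists>\<sigma>. (\<forall>k<n. \<sigma> k \<in> {..<s} \<times> {..<6}) \<and> det (mat n n (\<lambda>(k, j). \<rho> (\<sigma> k) j)) \<noteq> 0"
  proof (rule nonsingular_rows)
    fix g assume g: "\<And>r. r \<in> {..<s} \<times> {..<6} \<Longrightarrow> (\<Sum>j<n. g j * \<rho> r j) = 0"
    \<comment> \<open>Coefficients indexed by positions in \<open>es\<close>, turned into coefficients indexed by \<open>C\<close>.\<close>
    define g' where "g' e = g (THE j. j < n \<and> es ! j = e)" for e
    have g': "g' (es ! j) = g j" if "j < n" for j
    proof -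
      have "(THE k. k < n \<and> es ! k = es ! j) = j"
        using that es(2) by (intro the_equality) (auto simp: n_def nth_eq_iff_index_eq)
      then show ?thesis by (simp add: g'_def)
    qed
    have "\<forall>e\<in>C. g' e = 0"
    proof (rule determining_jets[OF p])
      fix i r assume ir: "i < s" "r < (6::nat)"
      have "(\<Sum>j<n. g j * \<rho> (i, r) j) = 0" using ir by (intro g) auto
      then show "(\<Sum>e\<in>C. g' e * (jet r e * monom_at (p i) e)) = 0"
        unfolding sum_es by (simp add: g' \<rho>_def)
    qed
    then show "\<forall>j<n. g j = 0" using g' es_in by metis
  qed
  then obtain \<sigma> where \<sigma>: "\<And>k. k < n \<Longrightarrow> \<sigma> k \<in> {..<s} \<times> {..<6}"
    "det (mat n n (\<lambda>(k, j). \<rho> (\<sigma> k) j)) \<noteq> 0" by blast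
  define A where "A = mat n n (\<lambda>(k, j).
      mterm (grid_monom (Pair (fst (\<sigma> k))) a b (es ! j)) (jet (snd (\<sigma> k)) (es ! j)))"
  have A: "A \<in> carrier_mat n n" by (simp add: A_def)
  define F where "F = det A"
  have eval_F: "cpoly_eval c F = det (mat n n (\<lambda>(k, j). jet (snd (\<sigma> k)) (es ! j) *
      monom_val c (grid_monom (Pair (fst (\<sigma> k))) a b (es ! j))))" for c
    unfolding F_def cpoly_eval_det[OF A] by (rule arg_cong[of _ _ det], rule eq_matI)
      (auto simp: A_def cpoly_eval_term)
  have "has_multidegree s (\<lambda>i. \<Sum>k<n. if i = fst (\<sigma> k) then a else 0)
      (\<lambda>i. \<Sum>k<n. if i = fst (\<sigma> k) then b else 0) F"
    unfolding F_def
  proof (rule has_multidegree_det[OF A])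
    fix k j assume kj: "k < n" "j < n"
    have "fst (\<sigma> k) < s" using \<sigma>(1)[OF kj(1)] by auto
    then show "has_multidegree s (\<lambda>i. if i = fst (\<sigma> k) then a else 0)
        (\<lambda>i. if i = fst (\<sigma> k) then b else 0) (A $$ (k, j))"
    proof -
      have "A $$ (k, j) = mterm (grid_monom (Pair (fst (\<sigma> k))) a b (es ! j)) (jet (snd (\<sigma> k)) (es ! j))"
        using kj by (simp add: A_def)
      moreover have "es ! j \<in> rect (a + 1) (b + 1)" using es_in[OF kj(2)] C by blast
      ultimately show ?thesis using \<open>fst (\<sigma> k) < s\<close> by (simp only: has_multidegree_entry)
    qed
  qed
  then have mh: "multihomogeneous s F"
    unfolding multihomogeneous_def has_multidegree_def
    by (intro conjI exI[of _ "\<lambda>i. (\<Sum>k<n. if i = fst (\<sigma> k) then a else 0, \<Sum>k<n. if i = fst (\<sigma> k) then b else 0)"]) blast+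
  \<comment> \<open>The open set where the minor does not vanish.\<close>
  define U where "U = {P \<in> configurations s. \<not> vanishes_at s F P}"
  have "configurations s - U = {P \<in> configurations s. \<forall>F\<in>{F}. vanishes_at s F P}"
    by (auto simp: U_def)
  then have "zariski_closed s (configurations s - U)"
    unfolding zariski_closed_def using mh by (intro exI[of _ "{F}"]) blast
  then have open_U: "zariski_open s U" unfolding zariski_open_def by (auto simp: U_def)
  define Q where "Q = (\<lambda>i. if i < s then (abs_p1 (1, fst (p i)), abs_p1 (1, snd (p i))) else undefined)"
  define c0 where "c0 = (\<lambda>(i, v). case_coord 1 (fst (p i)) 1 (snd (p i)) v)"
  have Q: "Q \<in> configurations s" by (auto simp: Q_def configurations_def PiE_def extensional_def)
  have c0: "(\<lambda>v. c0 (i, v)) \<in> point_coords (Q i)" if "i < s" for i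
  proof -
    have "proportional (1, x) (1, x)" for x by (simp add: proportional_def exI[of _ 1])
    then show ?thesis using that by (simp add: point_coords_def Q_def c0_def p1_coords_abs)
  qed
  have eval_c0: "cpoly_eval c0 F \<noteq> 0"
  proof -
    have "mat n n (\<lambda>(k, j). jet (snd (\<sigma> k)) (es ! j) *
        monom_val c0 (grid_monom (Pair (fst (\<sigma> k))) a b (es ! j))) = mat n n (\<lambda>(k, j). \<rho> (\<sigma> k) j)"
    proof (rule eq_matI)
      fix k j assume "k < dim_row (mat n n (\<lambda>(k, j). \<rho> (\<sigma> k) j))" "j < dim_col (mat n n (\<lambda>(k, j). \<rho> (\<sigma> k) j))"
      then have kj: "k < n" "j < n" by auto
      have "es ! j \<in> rect (a + 1) (b + 1)" using es_in[OF kj(2)] C by blast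
      then have "monom_val c0 (grid_monom (Pair (fst (\<sigma> k))) a b (es ! j)) = monom_at (p (fst (\<sigma> k))) (es ! j)"
        by (rule monom_val_torus) (simp_all add: c0_def)
      then show "mat n n (\<lambda>(k, j). jet (snd (\<sigma> k)) (es ! j) *
          monom_val c0 (grid_monom (Pair (fst (\<sigma> k))) a b (es ! j))) $$ (k, j) =
          mat n n (\<lambda>(k, j). \<rho> (\<sigma> k) j) $$ (k, j)"
        using kj by (simp add: \<rho>_def split: prod.splits)
    qed auto
    with \<sigma>(2) show ?thesis unfolding eval_F by (simp only: not_False_eq_True)
  qed
  have "\<not> vanishes_at s F Q"
  proof
    assume "vanishes_at s F Q"
    then have "(\<forall>i<s. (\<lambda>v. c0 (i, v)) \<in> point_coords (Q i)) \<longrightarrow> cpoly_eval c0 F = 0"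
      unfolding vanishes_at_def by (rule spec)
    then show False using c0 eval_c0 by blast
  qed
  then have "Q \<in> U" using Q by (simp add: U_def)
  moreover have "card C \<le> hilbert_function (triple_points_ideal s P) a b" if "P \<in> U" for P
  proof -
    obtain c where c: "\<And>i. i < s \<Longrightarrow> (\<lambda>v. c (i, v)) \<in> point_coords (P i)" "cpoly_eval c F \<noteq> 0"
    proof -
      have "\<not> (\<forall>c. (\<forall>i<s. (\<lambda>v. c (i, v)) \<in> point_coords (P i)) \<longrightarrow> cpoly_eval c F = 0)"
        using \<open>P \<in> U\<close> unfolding U_def vanishes_at_def by simp
      then show ?thesis using that by meson
    qed
    let ?M = "mat n n (\<lambda>(k, j). jet (snd (\<sigma> k)) (es ! j) *
      monom_val c (grid_monom (Pair (fst (\<sigma> k))) a b (es ! j)))"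
    let ?W = "triple_points_ideal s P \<inter> bihomogeneous a b"
    have "cpoly.dim ?W + card C \<le> (a + 1) * (b + 1)"
    proof (rule dim_le_complement[OF _ _ C])
      show "cpoly.subspace ?W"
        by (rule cpoly.subspace_inter[OF triple_points_ideal_subspace bihomogeneous_subspace])
      fix f assume f: "f \<in> ?W" and keys: "Poly_Mapping.keys f \<subseteq> grid_monom (\<lambda>v. v) a b ` C"
      define x where "x = vec n (\<lambda>j. coeff_of f (grid_monom (\<lambda>v. v) a b (es ! j)))"
      have x: "x \<in> carrier_vec n" by (simp add: x_def)
      have "?M *\<^sub>v x = 0\<^sub>v n"
      proof (rule eq_vecI)
        fix k assume "k < dim_vec (0\<^sub>v n :: complex vec)"
        then have k: "k < n" by simp
        obtain i r where ir: "\<sigma> k = (i, r)" "i < s" "r < 6" using \<sigma>(1)[OF k] by auto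
        have "f \<in> ideal_power (point_ideal (P i)) 3"
          using f ir(2) unfolding triple_points_ideal_def by blast
        from triple_point_jets[OF this c(1)[OF ir(2)] fin C keys ir(3)]
        have jets: "(\<Sum>e\<in>C. coeff_of f (grid_monom (\<lambda>v. v) a b e) *
          (jet r e * monom_val c (grid_monom (Pair i) a b e))) = 0"
          by (simp add: monom_val_grid_monom)
        show "(?M *\<^sub>v x) $ k = 0\<^sub>v n $ k"
        proof -
          have "(?M *\<^sub>v x) $ k = row ?M k \<bullet> x" using k by (intro index_mult_mat_vec) simp
          also have "\<dots> = (\<Sum>j<n. ?M $$ (k, j) * x $ j)"
            unfolding scalar_prod_def atLeast0LessThan
            by (rule sum.cong) (use k in \<open>simp_all add: x_def\<close>)
          also have "\<dots> = (\<Sum>j<n. coeff_of f (grid_monom (\<lambda>v. v) a b (es ! j)) *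
              (jet r (es ! j) * monom_val c (grid_monom (Pair i) a b (es ! j))))"
            by (rule sum.cong[OF refl]) (use k ir(1) in \<open>simp add: x_def\<close>)
          also have "\<dots> = 0" using jets unfolding sum_es .
          finally show ?thesis using k by simp
        qed
      qed simp
      moreover have "det ?M \<noteq> 0" using c(2) unfolding eval_F .
      ultimately have "x = 0\<^sub>v n"
        using det_0_iff_vec_prod_zero[OF mat_carrier, of n] x by blast
      then have zero: "coeff_of f (grid_monom (\<lambda>v. v) a b (es ! j)) = 0" if "j < n" for j
      proof -
        have "x $ j = 0" using \<open>x = 0\<^sub>v n\<close> that by simp
        then show ?thesis using that by (simp add: x_def)
      qed
      have "Poly_Mapping.keys f = {}"
      proof (rule ccontr)
        assume "Poly_Mapping.keys f \<noteq> {}"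
        then obtain m where m: "m \<in> Poly_Mapping.keys f" by blast
        then obtain e where e: "e \<in> C" "m = grid_monom (\<lambda>v. v) a b e" using keys by blast
        have "\<exists>j<n. es ! j = e" using e(1) unfolding es(1)[symmetric] n_def in_set_conv_nth .
        then obtain j where "j < n" "e = es ! j" by blast
        then show False using zero m e(2) by (simp add: in_keys_iff)
      qed
      then show "f = 0" by simp
    qed simp
    then show ?thesis by (simp add: hilbert_function_def)
  qed
  ultimately show ?thesis using open_U by blast
qed

section \<open>The Hilbert function of general triple points\<close>

theorem theorem4p6:
  fixes a b s :: nat
  assumes "a \<ge> b" and "b \<ge> 1" and "s \<ge> 1"
  shows "in_general_position s (\<lambda>P. hilbert_function (triple_points_ideal s P) a b =
    (if b = 1 \<and> real s < 2 / 5 * (real a + 1) then 5 * s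
     else if \<exists>k. s = 2 * k + 1 \<and> (a, b) = (4 * k + 1, 2) then (a + 1) * (b + 1) - 1
     else if \<exists>k. s = 2 * k + 1 \<and> (a, b) = (3 * k, 3) then (a + 1) * (b + 1) - 1
     else if \<exists>k. s = 2 * k + 1 \<and> (a, b) = (3 * k + 1, 3) then 6 * s - 1
     else if s = 5 \<and> (a, b) = (5, 4) then 29
     else min ((a + 1) * (b + 1)) (6 * s)))"
  unfolding general_value_def[symmetric]
proof -
  obtain C where C: "C \<subseteq> rect (a + 1) (b + 1)" "card C = general_value a b s" "determined s C"
    using determined_general_value[OF assms(1,2)] by blast
  obtain U where U: "zariski_open s U" "U \<noteq> {}"
    "\<And>P. P \<in> U \<Longrightarrow> card C \<le> hilbert_function (triple_points_ideal s P) a b"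
    using independent_conditions_general[OF C(1,3)] by blast
  have "hilbert_function (triple_points_ideal s P) a b = general_value a b s" if "P \<in> U" for P
    using U(3)[OF that] C(2) hilbert_function_le_general_value[OF assms(1,2)] by (metis le_antisym)
  then show "in_general_position s
      (\<lambda>P. hilbert_function (triple_points_ideal s P) a b = general_value a b s)"
    unfolding in_general_position_def using U(1,2) by blast
qed

end
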